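(* Let $\alpha\in(0,1)$, $k\ge1$, and let $\widetilde{\mathbb{A}}\in\mathbb{R}^{N\times N}$ be a symmetric positive definite matrix (the finite difference matrix) with smallest eigenvalue $\lambda_1>0$. Assume that $\widetilde{\mathbb{A}}$ is an M-matrix, i.e. all its diagonal entries are positive and all its off-diagonal entries are non-positive. If $\widetilde f_h\in\mathbb{R}^N$ has all its entries non-negative, then the vector $$\widetilde w_h=\lambda_1^{-\alpha}\,r_{\alpha,k}(\lambda_1\widetilde{\mathbb{A}}^{-1})\,\widetilde f_h$$ has all its entries non-negative.
   Context: For $\alpha\in(0,1)$ and $k\ge1$, $\mathcal{R}_k$ denotes the set of rational functions $P(t)/Q(t)$ with $P,Q$ real polynomials of degree at most $k$ and $Q(0)=1$; $r_{\alpha,k}\in\mathcal{R}_k$ denotes the best uniform rational approximation (BURA) of $t^\alpha$ on $[0,1]$, i.e. the (unique) minimizer of $\|s(t)-t^\alpha\|_{L^\infty[0,1]}$ over $s\in\mathcal{R}_k$. It is known (Saff–Stahl) that $r_{\alpha,k}=P/Q$ with $P$ and $Q$ of exact degree $k$, whose roots $\zeta_1,\dots,\zeta_k$ (of $P$) and $d_1,\dots,d_k$ (of $Q$) satisfy $0>\zeta_1>d_1>\zeta_2>d_2>\cdots>\zeta_k>d_k$. For a symmetric matrix $B$ with spectrum in $(0,1]$, $r_{\alpha,k}(B)=P(B)Q(B)^{-1}$. *)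

theory Defs
  imports "HOL-Analysis.Analysis" "HOL-Computational_Algebra.Polynomial"
    "HOL-Probability.Essential_Supremum"
begin

section \<open>Best uniform rational approximation of \<open>t\<^sup>\<alpha>\<close> on \<open>[0,1]\<close>\<close>

text \<open>A rational function \<open>P/Q\<close> is represented by the pair \<open>(P, Q)\<close>; the pair need not be coprime.\<close>

definition rational_funs :: "nat \<Rightarrow> (real poly \<times> real poly) set" where
  "rational_funs k = {(P, Q). degree P \<le> k \<and> degree Q \<le> k \<and> poly Q 0 = 1}"

definition rat_eval :: "real poly \<times> real poly \<Rightarrow> real \<Rightarrow> real" where
  "rat_eval s t = poly (fst s) t / poly (snd s) t"

text \<open>
  The \<open>L\<^sup>\<infinity>[0,1]\<close> norm takes the value \<open>\<infinity>\<close> when \<open>s\<close> has a pole in \<open>[0,1]\<close>. Being an essential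
  supremum, it does not depend on the values \<open>x / 0 = 0\<close> at the finitely many zeros of the
  denominator.
\<close>

definition Linfty_norm01 :: "(real \<Rightarrow> real) \<Rightarrow> ereal" where
  "Linfty_norm01 g = esssup (lebesgue_on {0..1}) (\<lambda>t. ereal \<bar>g t\<bar>)"

definition is_BURA :: "real \<Rightarrow> nat \<Rightarrow> real poly \<times> real poly \<Rightarrow> bool" where
  "is_BURA \<alpha> k r \<longleftrightarrow> r \<in> rational_funs k \<and>
     (\<forall>s \<in> rational_funs k. Linfty_norm01 (\<lambda>t. rat_eval r t - t powr \<alpha>)
                          \<le> Linfty_norm01 (\<lambda>t. rat_eval s t - t powr \<alpha>))"

section \<open>Matrices\<close>

definition matrix_power :: "real^'n^'n \<Rightarrow> nat \<Rightarrow> real^'n^'n" where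
  "matrix_power B i = ((\<lambda>M. B ** M) ^^ i) (mat 1)"

definition poly_matrix :: "real poly \<Rightarrow> real^'n^'n \<Rightarrow> real^'n^'n" where
  "poly_matrix p B = (\<Sum>i\<le>degree p. coeff p i *\<^sub>R matrix_power B i)"

definition rat_matrix :: "real poly \<times> real poly \<Rightarrow> real^'n^'n \<Rightarrow> real^'n^'n" where
  "rat_matrix s B = poly_matrix (fst s) B ** matrix_inv (poly_matrix (snd s) B)"

definition symmetric_matrix :: "real^'n^'n \<Rightarrow> bool" where
  "symmetric_matrix A \<longleftrightarrow> transpose A = A"

definition positive_definite :: "real^'n^'n \<Rightarrow> bool" where
  "positive_definite A \<longleftrightarrow> (\<forall>x. x \<noteq> 0 \<longrightarrow> x \<bullet> (A *v x) > 0)"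

definition is_eigenvalue :: "real^'n^'n \<Rightarrow> real \<Rightarrow> bool" where
  "is_eigenvalue A \<mu> \<longleftrightarrow> (\<exists>v. v \<noteq> 0 \<and> A *v v = \<mu> *\<^sub>R v)"

definition smallest_eigenvalue :: "real^'n^'n \<Rightarrow> real \<Rightarrow> bool" where
  "smallest_eigenvalue A \<mu> \<longleftrightarrow> is_eigenvalue A \<mu> \<and> (\<forall>\<nu>. is_eigenvalue A \<nu> \<longrightarrow> \<mu> \<le> \<nu>)"

text \<open>Only the sign pattern; the full notion of M-matrix also needs positive definiteness, which is
  a separate hypothesis where this is used.\<close>

definition M_matrix :: "real^'n^'n \<Rightarrow> bool" where
  "M_matrix A \<longleftrightarrow> (\<forall>i. A $ i $ i > 0) \<and> (\<forall>i j. i \<noteq> j \<longrightarrow> A $ i $ j \<le> 0)"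

end

theory Submission
  imports Defs "HOL-Computational_Algebra.Field_as_Ring" "HOL-Computational_Algebra.Polynomial_Factorial"
begin

text \<open>
  With \<open>B = \<lambda>\<^sub>1 A\<^bsup>-1\<^esup>\<close> the claim says that \<open>r(B)\<close> preserves nonnegative vectors, where
  \<open>r = P/Q\<close> is the best approximation.  It follows from a partial fraction expansion
  \<open>r(t) = c + \<Sum>\<^sub>d e\<^sub>d t / (1 - t/d)\<close> with \<open>c \<ge> 0\<close>, \<open>e\<^sub>d > 0\<close> and poles \<open>d < 0\<close>: at
  \<open>t = B\<close> each term with a pole becomes a positive multiple of \<open>(A/\<lambda>\<^sub>1 - 1/d)\<^bsup>-1\<^esup>\<close>, the inverse of a positive
  definite matrix with nonpositive off-diagonal entries, which is entrywise nonnegative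
  (\<open>M_matrix_inverse_nonneg\<close>, \<open>partial_fraction_matrix_nonneg\<close>).

  The expansion has to be derived from the minimality of \<open>r\<close> alone.  There are two steps.

  The first step shows that \<open>r\<close> agrees with \<open>t\<^bsup>\<alpha>\<^esup>\<close> at \<open>2 k + 1\<close> points of \<open>(0, 1)\<close>
  (\<open>BURA_interpolates\<close>).  If the error had fewer zeros than the tangent space of the rational
  functions at \<open>r\<close> has dimensions, some tangent direction would have the sign of the error everywhere,
  and moving along it would improve the approximation (\<open>improved_rational_approximation\<close>).  The
  Chebyshev property of real powers (\<open>power_sum_zeros_less\<close>) bounds the number of zeros from above,
  and the two bounds are compatible only if \<open>P/Q\<close> is a reduced fraction whose numerator and
  denominator both have degree \<open>k\<close>.

  The second step reads off the poles and residues from this interpolation property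
  (\<open>interpolant_partial_fractions\<close>).  Classically one would use that \<open>t\<^bsup>\<alpha>\<^esup>\<close> is a Stieltjes
  function, so that \<open>Q\<close> is orthogonal to lower degrees on the negative axis.  Here the same positivity
  enters through one lemma (\<open>residue_negative\<close>): for a nonzero polynomial \<open>g\<close> that is nonnegative on the
  negative axis and has degree less than \<open>2 k\<close>, the derivative of order \<open>2 k\<close> of \<open>t\<^bsup>\<alpha>\<^esup> g(t)\<close> is
  negative for all \<open>t > 0\<close>, since by the Beta integral it is a negative multiple of an integral of
  the values of \<open>g\<close> on the negative axis.  Combined with Rolle's theorem and suitable multipliers \<open>g\<close>
  this excludes that \<open>Q\<close> has fewer than \<open>k\<close> negative roots and fixes the sign of every residue.
\<close>

section \<open>Zeros of sums of real powers\<close>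

text \<open>
  Away from \<open>0\<close> the operator \<open>f \<mapsto> t f' - b f\<close> is \<open>t\<^bsup>b + 1\<^esup>\<close> times the derivative of
  \<open>t\<^bsup>- b\<^esup> f\<close>, so Rolle's theorem between consecutive positive zeros of \<open>f\<close> shows that it destroys
  at most one of them.  The bound by \<open>Max Z\<close> keeps the zeros found for an initial segment of \<open>Z\<close>
  apart from the one produced by the last gap.
\<close>

lemma rolle_step:
  fixes f g :: "real \<Rightarrow> real" and b :: real
  assumes deriv: "\<And>t. 0 < t \<Longrightarrow> \<exists>D. (f has_real_derivative D) (at t) \<and> g t = t * D - b * f t"
    and "finite Z" "Z \<noteq> {}" "Z \<subseteq> {0<..}" "\<And>z. z \<in> Z \<Longrightarrow> f z = 0"
  shows "\<exists>Z'. finite Z' \<and> Suc (card Z') = card Z \<and> (\<forall>z\<in>Z'. 0 < z \<and> z < Max Z \<and> g z = 0)"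
  using assms(2-)
proof (induction rule: finite_linorder_max_induct)
  case empty
  then show ?case by simp
next
  case (insert x A)
  show ?case
  proof (cases "A = {}")
    case True
    then show ?thesis by (intro exI[of _ "{}"]) simp
  next
    case False
    then obtain Z' where Z': "finite Z'" "Suc (card Z') = card A"
      "\<forall>z\<in>Z'. 0 < z \<and> z < Max A \<and> g z = 0"
      using insert by auto
    define a where "a = Max A"
    have "a \<in> A" using False insert(1) unfolding a_def by simp
    then have a: "0 < a" "a < x" "f a = 0" "f x = 0" using insert by auto
    have D: "((\<lambda>t. t powr (- b) * f t) has_real_derivative t powr (- b - 1) * g t) (at t)"
      if t: "0 < t" for t
    proof -
      from deriv[OF t] obtain D where D: "(f has_real_derivative D) (at t)" "g t = t * D - b * f t"
        by blast
      have "((\<lambda>t. t powr (- b) * f t) has_real_derivative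
          (- b) * t powr (- b - 1) * f t + t powr (- b) * D) (at t)"
        by (rule derivative_eq_intros D refl has_real_derivative_powr t | use t in simp)+
      moreover have "t powr (- b) = t powr (- b - 1) * t"
        using t by (simp add: powr_diff field_simps)
      moreover have "(- b) * (t powr (- b - 1)) * f t + t powr (- b - 1) * t * D = t powr (- b - 1) * g t"
        unfolding D(2) by (simp add: algebra_simps)
      ultimately show ?thesis by simp
    qed
    have "\<exists>z. a < z \<and> z < x \<and> DERIV (\<lambda>t. t powr (- b) * f t) z :> 0"
    proof (rule Rolle)
      show "continuous_on {a..x} (\<lambda>t. t powr (- b) * f t)"
        using DERIV_isCont[OF D] a(1) by (intro continuous_at_imp_continuous_on ballI) simp
      show "(\<lambda>t. t powr (- b) * f t) differentiable at t" if "a < t" "t < x" for t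
        using D[of t] a(1) that real_differentiable_def by fastforce
    qed (use a in auto)
    then obtain z where z: "a < z" "z < x" "DERIV (\<lambda>t. t powr (- b) * f t) z :> 0" by blast
    have "z powr (- b - 1) * g z = 0"
      using DERIV_unique[OF z(3) D] a z by simp
    then have gz: "g z = 0" using a z by auto
    have M: "Max (insert x A) = x"
      using a(2) insert(1) False unfolding a_def by simp
    have "z \<notin> Z'" using Z'(3) z unfolding a_def by fastforce
    moreover have "x \<notin> A" using insert(2) by auto
    ultimately show ?thesis
      using Z' z gz a M insert(1) unfolding a_def[symmetric]
      by (intro exI[of _ "insert z Z'"]) auto
  qed
qed

lemma rolle_chain:
  fixes D :: "nat \<Rightarrow> real \<Rightarrow> real" and b :: "nat \<Rightarrow> real"
  assumes step: "\<And>j t. j < n \<Longrightarrow> 0 < t \<Longrightarrow>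
      \<exists>D'. (D j has_real_derivative D') (at t) \<and> D (Suc j) t = t * D' - b j * D j t"
    and Z: "finite Z" "Z \<subseteq> {0<..}" "card Z = Suc n" "\<And>z. z \<in> Z \<Longrightarrow> D 0 z = 0"
  shows "\<exists>z>0. D n z = 0"
proof -
  have "\<exists>Z'. finite Z' \<and> Z' \<subseteq> {0<..} \<and> card Z' + j = Suc n \<and> (\<forall>z\<in>Z'. D j z = 0)"
    if "j \<le> n" for j
    using that
  proof (induction j)
    case 0
    then show ?case using Z by auto
  next
    case (Suc j)
    then obtain Z' where Z': "finite Z'" "Z' \<subseteq> {0<..}" "card Z' + j = Suc n" "\<forall>z\<in>Z'. D j z = 0"
      by auto
    then have "Z' \<noteq> {}" using Suc(2) by auto
    with rolle_step[of "D j" "D (Suc j)" "b j" Z'] step[of j] Suc(2) Z'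
    obtain Z'' where "finite Z''" "Suc (card Z'') = card Z'"
      "\<forall>z\<in>Z''. 0 < z \<and> z < Max Z' \<and> D (Suc j) z = 0"
      by auto
    with Z' show ?case by (intro exI[of _ Z'']) auto
  qed
  from this[of n] obtain Z' where "Z' \<subseteq> {0<..}" "card Z' = 1" "\<forall>z\<in>Z'. D n z = 0" by auto
  then show ?thesis by (auto simp: card_1_singleton_iff)
qed

text \<open>
  The power \<open>t\<^bsup>a\<^esup>\<close> is an eigenfunction of \<open>f \<mapsto> t f' - b f\<close> with eigenvalue \<open>a - b\<close>.
  Iterating the operator therefore only multiplies the coefficients by products of such differences.
\<close>

lemma power_sum_euler_step:
  fixes c a :: "'i \<Rightarrow> real"
  assumes "0 < t"
  shows "\<exists>D'. ((\<lambda>t. \<Sum>i\<in>I. c i * (\<Prod>l<j. a i - b l) * t powr a i) has_real_derivative D') (at t)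
    \<and> (\<Sum>i\<in>I. c i * (\<Prod>l<Suc j. a i - b l) * t powr a i)
        = t * D' - b j * (\<Sum>i\<in>I. c i * (\<Prod>l<j. a i - b l) * t powr a i)"
proof (intro exI conjI)
  show "((\<lambda>t. \<Sum>i\<in>I. c i * (\<Prod>l<j. a i - b l) * t powr a i) has_real_derivative
      (\<Sum>i\<in>I. c i * (\<Prod>l<j. a i - b l) * (a i * t powr (a i - 1)))) (at t)"
    by (intro DERIV_sum DERIV_cmult has_real_derivative_powr assms)
  have pw: "t * (y * (x * t powr (x - 1))) = x * (y * t powr x)" for x y
    using assms by (simp add: powr_diff)
  show "(\<Sum>i\<in>I. c i * (\<Prod>l<Suc j. a i - b l) * t powr a i)
      = t * (\<Sum>i\<in>I. c i * (\<Prod>l<j. a i - b l) * (a i * t powr (a i - 1)))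
        - b j * (\<Sum>i\<in>I. c i * (\<Prod>l<j. a i - b l) * t powr a i)"
    unfolding sum_distrib_left sum_subtractf[symmetric]
    by (intro sum.cong refl) (simp only: pw, simp add: algebra_simps)
qed

text \<open>
  Applying the operators with parameters in \<open>B\<close> annihilates all powers with exponent in \<open>B\<close>, at the
  price of at most one zero per exponent.  A suitable \<open>B\<close> isolates any desired part of the sum.
\<close>

lemma power_sum_elimination:
  fixes c a :: "'i \<Rightarrow> real"
  assumes "finite I" "finite B" "Z \<subseteq> {0<..}" "card B < card Z"
    and "\<And>z. z \<in> Z \<Longrightarrow> (\<Sum>i\<in>I. c i * z powr a i) = 0"
  shows "\<exists>z>0. (\<Sum>i\<in>I. c i * (\<Prod>b\<in>B. a i - b) * z powr a i) = 0"
proof -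
  obtain b where b: "bij_betw b {0..<card B} B" using ex_bij_betw_nat_finite[OF assms(2)] by blast
  obtain Z' where Z': "Z' \<subseteq> Z" "card Z' = Suc (card B)"
    using obtain_subset_with_card_n[of "Suc (card B)" Z] assms(4) by auto
  have "\<exists>z>0. (\<Sum>i\<in>I. c i * (\<Prod>l<card B. a i - b l) * z powr a i) = 0"
  proof (rule rolle_chain[where n = "card B" and Z = Z' and b = b and
        D = "\<lambda>j t. \<Sum>i\<in>I. c i * (\<Prod>l<j. a i - b l) * t powr a i"])
  qed (use power_sum_euler_step assms Z' card_ge_0_finite[of Z'] in \<open>auto simp: subset_eq\<close>)
  moreover have "(\<Prod>l<card B. a i - b l) = (\<Prod>b\<in>B. a i - b)" for i
    using prod.reindex_bij_betw[OF b, of "\<lambda>b. a i - b"] by (simp add: atLeast0LessThan)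
  ultimately show ?thesis by simp
qed

text \<open>
  Real powers form a Chebyshev system on the positive axis: after eliminating all exponents but one,
  a single nonzero multiple of a power would still have a zero.
\<close>

lemma power_sum_zeros_less:
  fixes c a :: "'i \<Rightarrow> real"
  assumes "finite I" "inj_on a I" "r \<in> I" "c r \<noteq> 0" "finite Z" "Z \<subseteq> {0<..}"
    and "\<And>z. z \<in> Z \<Longrightarrow> (\<Sum>i\<in>I. c i * z powr a i) = 0"
  shows "card Z < card I"
proof (rule ccontr)
  assume many: "\<not> card Z < card I"
  define B where "B = a ` (I - {r})"
  have "card B = card I - 1" "card I > 0" unfolding B_def
    using assms(1-3) by (auto simp: card_image inj_on_diff card_gt_0_iff)
  then have "\<exists>z>0. (\<Sum>i\<in>I. c i * (\<Prod>b\<in>B. a i - b) * z powr a i) = 0"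
    using many assms by (intro power_sum_elimination[where Z = Z]) (auto simp: B_def)
  then obtain z where z: "z > 0" "(\<Sum>i\<in>I. c i * (\<Prod>b\<in>B. a i - b) * z powr a i) = 0" by blast
  have "(\<Sum>i\<in>I. c i * (\<Prod>b\<in>B. a i - b) * z powr a i) =
      c r * (\<Prod>b\<in>B. a r - b) * z powr a r"
    using assms(1,3) by (subst sum.remove[of _ r]) (auto intro!: sum.neutral simp: B_def)
  moreover have "(\<Prod>b\<in>B. a r - b) \<noteq> 0"
    using assms(1-3) unfolding B_def by (auto simp: inj_on_def)
  ultimately show False using z assms(4) by simp
qed

text \<open>
  A sum with the largest possible number of positive zeros has coefficients of alternating sign
  (Descartes).  Only the two lowest exponents matter below: eliminating all the others multiplies
  their coefficients by numbers of equal sign, and the remaining two terms cancel somewhere.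
\<close>

lemma power_sum_lowest_signs:
  fixes c a :: "'i \<Rightarrow> real"
  assumes "finite I" "inj_on a I" "r \<in> I" "s \<in> I" "r \<noteq> s"
    and low: "\<And>i. i \<in> I \<Longrightarrow> i \<noteq> r \<Longrightarrow> i \<noteq> s \<Longrightarrow> a r < a i \<and> a s < a i"
    and "finite Z" "Z \<subseteq> {0<..}" "card I \<le> Suc (card Z)"
    and "\<And>z. z \<in> Z \<Longrightarrow> (\<Sum>i\<in>I. c i * z powr a i) = 0"
  shows "c r * c s \<le> 0"
proof -
  define B where "B = a ` (I - {r, s})"
  have "card {r, s} \<le> card I"
    by (rule card_mono) (use assms in auto)
  moreover have "card B = card I - 2" unfolding B_def
    using assms(1-5) by (subst card_image) (auto simp: inj_on_diff card_Diff_subset)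
  ultimately have "card B < card Z" using assms(5,9) by simp
  then have "\<exists>z>0. (\<Sum>i\<in>I. c i * (\<Prod>b\<in>B. a i - b) * z powr a i) = 0"
    using assms by (intro power_sum_elimination[where Z = Z]) (auto simp: B_def)
  then obtain z where z: "z > 0" "(\<Sum>i\<in>I. c i * (\<Prod>b\<in>B. a i - b) * z powr a i) = 0" by blast
  have "(\<Sum>i\<in>I. c i * (\<Prod>b\<in>B. a i - b) * z powr a i) =
      (\<Sum>i\<in>{r, s}. c i * (\<Prod>b\<in>B. a i - b) * z powr a i)"
    using assms(1,3,4) by (intro sum.mono_neutral_right) (auto simp: B_def)
  with z assms(5) have
    0: "c r * ((\<Prod>b\<in>B. a r - b) * z powr a r) + c s * ((\<Prod>b\<in>B. a s - b) * z powr a s) = 0"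
    by (simp add: mult.assoc)
  have "(\<Prod>b\<in>B. a r - b) * (\<Prod>b\<in>B. a s - b) = (\<Prod>b\<in>B. (a r - b) * (a s - b))"
    by (simp add: prod.distrib)
  also have "\<dots> > 0"
    using low by (intro prod_pos) (auto simp: B_def intro!: mult_neg_neg)
  finally have "0 < ((\<Prod>b\<in>B. a r - b) * (\<Prod>b\<in>B. a s - b)) * (z powr a r * z powr a s)"
    using z(1) by simp
  then have "0 < ((\<Prod>b\<in>B. a r - b) * z powr a r) * ((\<Prod>b\<in>B. a s - b) * z powr a s)"
    by (simp only: ac_simps)
  moreover have "x * y \<le> 0" if "x * u + y * v = 0" "0 < u * v" for x y u v :: real
  proof -
    have "(x * y) * (u * v) = - ((x * u) * (x * u))" using that(1) by algebra
    then have "(x * y) * (u * v) \<le> 0" by simp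
    then show ?thesis using that(2) by (meson mult_pos_pos not_less)
  qed
  ultimately show ?thesis using 0 by blast
qed

section \<open>Matching the sign pattern of a function by a polynomial\<close>

lemma nonvanishing_constant_sign:
  fixes f :: "real \<Rightarrow> real"
  assumes "is_interval S" "continuous_on S f" "\<And>t. t \<in> S \<Longrightarrow> f t \<noteq> 0"
  obtains \<sigma> :: real where "\<sigma> = 1 \<or> \<sigma> = -1" "\<And>t. t \<in> S \<Longrightarrow> 0 < \<sigma> * f t"
proof -
  have "is_interval (f ` S)"
    using assms(1,2) by (simp add: is_interval_connected_1 connected_continuous_image)
  then have "\<And>a b x. a \<in> f ` S \<Longrightarrow> b \<in> f ` S \<Longrightarrow> a \<le> x \<Longrightarrow> x \<le> b \<Longrightarrow> x \<in> f ` S"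
    by (meson mem_is_interval_1_I)
  then have "(\<forall>t\<in>S. 0 < f t) \<or> (\<forall>t\<in>S. f t < 0)"
    using assms(3) by (smt (verit) imageE imageI)
  then show thesis using that[of 1] that[of "-1"] by auto
qed

text \<open>
  The set \<open>Z'\<close> consists of the zeros at which \<open>f\<close> really changes sign.  It is built from left to
  right: the largest zero is included exactly if the sign of \<open>f\<close> beyond it differs from the sign that
  the product found so far would have there.
\<close>

lemma sign_matching_product:
  fixes f :: "real \<Rightarrow> real"
  assumes "is_interval S" "continuous_on S f" "finite Z" "{t \<in> S. f t = 0} = Z"
  shows "\<exists>Z' \<sigma>. Z' \<subseteq> Z \<and> (\<sigma> = 1 \<or> \<sigma> = -1) \<and> (\<forall>t\<in>S - Z. 0 < \<sigma> * (\<Prod>z\<in>Z'. t - z) * f t)"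
  using assms(3,1,2,4)
proof (induction arbitrary: S rule: finite_linorder_max_induct)
  case empty
  then have nz: "\<And>t. t \<in> S \<Longrightarrow> f t \<noteq> 0" by auto
  show ?case
    by (rule nonvanishing_constant_sign[OF empty(1,2) nz]) auto
next
  case (insert x A)
  define L where "L = S \<inter> {..<x}"
  define R where "R = S \<inter> {x<..}"
  have int: "is_interval L" "is_interval R"
    using insert.prems(1) unfolding L_def R_def is_interval_1 by auto
  have cont: "continuous_on L f" "continuous_on R f"
    using insert.prems(2) unfolding L_def R_def by (auto intro: continuous_on_subset)
  have "{t \<in> L. f t = 0} = A"
    using insert.prems(3) insert(2) unfolding L_def by auto
  then obtain Z' \<sigma> where Z': "Z' \<subseteq> A" "\<sigma> = 1 \<or> \<sigma> = (-1::real)"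
    "\<forall>t\<in>L - A. 0 < \<sigma> * (\<Prod>z\<in>Z'. t - z) * f t"
    using insert.IH[OF int(1) cont(1)] by blast
  have fin: "finite Z'" using Z'(1) insert(1) finite_subset by blast
  have "\<And>t. t \<in> R \<Longrightarrow> f t \<noteq> 0"
    using insert.prems(3) insert(2) unfolding R_def by fastforce
  then obtain \<tau> :: real where \<tau>: "\<tau> = 1 \<or> \<tau> = -1" "\<And>t. t \<in> R \<Longrightarrow> 0 < \<tau> * f t"
    using nonvanishing_constant_sign[OF int(2) cont(2)] by metis
  have R: "0 < \<tau> * (\<Prod>z\<in>Z'. t - z) * f t" if "t \<in> R" for t
  proof -
    have "0 < (\<Prod>z\<in>Z'. t - z)"
      using that Z'(1) insert(2) unfolding R_def by (intro prod_pos) fastforce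
    then have "0 < (\<Prod>z\<in>Z'. t - z) * (\<tau> * f t)" using \<tau>(2)[OF that] by simp
    then show ?thesis by (simp only: ac_simps)
  qed
  have split: "t \<in> L - A \<or> t \<in> R" if "t \<in> S - insert x A" for t
    using that unfolding L_def R_def by auto
  show ?case
  proof (cases "\<tau> = \<sigma>")
    case True
    with R Z' split show ?thesis by (intro exI[of _ Z'] exI[of _ \<sigma>]) blast
  next
    case False
    then have \<tau>\<sigma>: "\<tau> = - \<sigma>" using \<tau>(1) Z'(2) by auto
    have "x \<notin> Z'" using Z'(1) insert(2) by auto
    then have eq: "\<tau> * (\<Prod>z\<in>insert x Z'. t - z) * f t = (t - x) * (\<tau> * (\<Prod>z\<in>Z'. t - z) * f t)" for t
      using fin by simp
    have "0 < \<tau> * (\<Prod>z\<in>insert x Z'. t - z) * f t" if "t \<in> S - insert x A" for t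
    proof (cases "t \<in> R")
      case True
      then show ?thesis using R[OF True] unfolding eq R_def by auto
    next
      case False
      then have "t \<in> L - A" using split[OF that] by blast
      then have "t - x < 0" "\<tau> * (\<Prod>z\<in>Z'. t - z) * f t < 0"
        using Z'(3) unfolding \<tau>\<sigma> L_def by auto
      then show ?thesis unfolding eq by (rule mult_neg_neg)
    qed
    with Z' \<tau> show ?thesis by (intro exI[of _ "insert x Z'"] exI[of _ \<tau>]) auto
  qed
qed

section \<open>Improving a rational approximation whose error has few zeros\<close>

lemma coprime_polys_bezout:
  fixes p q :: "real poly"
  assumes "coprime p q"
  obtains a b where "a * p + b * q = 1"
  using bezout_coefficients_fst_snd[of p q] assms by (metis coprime_iff_gcd_eq_1)

lemma coprime_polys_bezout_degree:
  fixes p q w :: "real poly"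
  assumes "coprime p q" "p \<noteq> 0" "degree p \<le> k" "degree q \<le> k" "degree p \<ge> degree q"
    and "degree w \<le> k + degree p"
  shows "\<exists>u v. degree u \<le> k \<and> degree v \<le> k \<and> w = u * q - v * p"
proof -
  obtain a b where ab: "a * p + b * q = 1" using coprime_polys_bezout[OF assms(1)] .
  define u where "u = (w * b) mod p"
  define v where "v = - (w * a) - (w * b) div p * q"
  have eq: "w = u * q - v * p"
  proof -
    have "w = w * (a * p + b * q)" using ab by simp
    also have "\<dots> = w * a * p + ((w * b) div p * p + u) * q"
      unfolding u_def by (simp add: algebra_simps)
    also have "\<dots> = u * q - v * p" unfolding v_def by (simp add: algebra_simps)
    finally show ?thesis .
  qed
  have du: "degree u \<le> degree p"
    using degree_mod_less'[OF assms(2), of "w * b"] unfolding u_def by fastforce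
  have "degree v \<le> k"
  proof (cases "v = 0")
    case False
    have "v * p = u * q - w" using eq by simp
    then have "degree v + degree p = degree (u * q - w)"
      using False assms(2) by (metis degree_mult_eq)
    also have "\<dots> \<le> max (degree (u * q)) (degree w)" by (rule degree_diff_le_max)
    also have "\<dots> \<le> k + degree p"
      using du assms degree_mult_le[of u q] by auto
    finally show ?thesis by simp
  qed simp
  with eq du assms(3) show ?thesis by (intro exI[of _ u] exI[of _ v]) auto
qed

text \<open>
  The tangent directions to the rational functions of degree at most \<open>k\<close> at \<open>p/q\<close> are
  \<open>(u q - v p)/q\<^sup>2\<close>.  For coprime \<open>p\<close> and \<open>q\<close> the numerators exhaust all polynomials of degree at most
  \<open>k + max (degree p) (degree q)\<close>: reduce a Bezout representation of \<open>w\<close> modulo the one of \<open>p\<close>, \<open>q\<close>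
  which has the larger degree.
\<close>

lemma coprime_polys_cross_image:
  fixes p q w :: "real poly"
  assumes "coprime p q" "q \<noteq> 0" "degree p \<le> k" "degree q \<le> k"
    and "degree w \<le> k + max (degree p) (degree q)"
  shows "\<exists>u v. degree u \<le> k \<and> degree v \<le> k \<and> w = u * q - v * p"
proof (cases "degree q \<le> degree p \<and> p \<noteq> 0")
  case True
  then show ?thesis using coprime_polys_bezout_degree[of p q k w] assms by auto
next
  case False
  then have "degree p \<le> degree q" by auto
  moreover from this have "degree (- w) \<le> k + degree q" using assms(5) by simp
  ultimately obtain u v where "degree u \<le> k" "degree v \<le> k" "- w = u * p - v * q"
    using coprime_polys_bezout_degree[of q p k "- w"] assms by (auto simp: coprime_commute)
  moreover from this have "w = v * q - u * p" by (metis minus_diff_eq minus_minus)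
  ultimately show ?thesis by blast
qed

lemma same_sign_diff_less:
  fixes a b :: real
  assumes "0 < a * b" "\<bar>a\<bar> \<le> E" "\<bar>b\<bar> \<le> E"
  shows "\<bar>a - b\<bar> < E"
  using assms by (auto simp: zero_less_mult_iff abs_if split: if_splits)

text \<open>
  If the error \<open>e\<close> has so few zeros that a polynomial \<open>w\<close> with the sign pattern of \<open>e\<close> is a numerator
  \<open>u q - v p\<close>, then moving from \<open>p/q\<close> to \<open>(p + \<epsilon> u)/(q + \<epsilon> v)\<close> subtracts from \<open>e\<close> a small
  function \<open>\<eta>\<close> of the same sign as \<open>e\<close>, which lowers its maximum.  Pointwise \<open>\<bar>e - \<eta>\<bar> < E\<close> is
  enough, since the new maximum is attained.  This replaces the usual argument with alternation points.
\<close>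

lemma improved_rational_approximation:
  fixes p q :: "real poly" and f :: "real \<Rightarrow> real"
  assumes cop: "coprime p q" and deg: "degree p \<le> k" "degree q \<le> k"
    and qpos: "\<And>t. t \<in> {0..1} \<Longrightarrow> 0 < poly q t"
    and f: "continuous_on {0..1} f"
    and Z: "finite Z" "{t \<in> {0<..<1}. f t - poly p t / poly q t = 0} = Z"
      "card Z \<le> k + max (degree p) (degree q)"
    and E: "0 < E" "\<And>t. t \<in> {0..1} \<Longrightarrow> \<bar>f t - poly p t / poly q t\<bar> \<le> E"
  shows "\<exists>p' q' E'. degree p' \<le> k \<and> degree q' \<le> k \<and> E' < E \<and>
    (\<forall>t\<in>{0..1}. 0 < poly q' t \<and> \<bar>f t - poly p' t / poly q' t\<bar> \<le> E')"
proof -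
  define e where "e t = f t - poly p t / poly q t" for t
  have e_cont: "continuous_on {0..1} e"
    unfolding e_def using qpos f by (fastforce intro!: continuous_intros)
  have "is_interval {0<..<1::real}" by (simp add: is_interval_1)
  moreover have "continuous_on {0<..<1} e" using e_cont by (rule continuous_on_subset) auto
  ultimately obtain Z' \<sigma> where Z': "Z' \<subseteq> Z" "\<sigma> = 1 \<or> \<sigma> = (-1::real)"
    "\<forall>t\<in>{0<..<1} - Z. 0 < \<sigma> * (\<Prod>z\<in>Z'. t - z) * e t"
    using sign_matching_product[of "{0<..<1}" e Z] Z unfolding e_def by blast
  define w where "w = smult \<sigma> (\<Prod>z\<in>Z'. [:- z, 1:])"
  have w: "poly w t = \<sigma> * (\<Prod>z\<in>Z'. t - z)" for t
    unfolding w_def by (simp add: poly_prod)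
  have finZ': "finite Z'" using Z' Z finite_subset by blast
  have "degree w \<le> card Z'"
    unfolding w_def using degree_prod_sum_le[OF finZ', of "\<lambda>z. [:- z, 1:]"] by simp
  then have "degree w \<le> k + max (degree p) (degree q)"
    using Z(3) card_mono[OF Z(1) Z'(1)] by linarith
  moreover have "q \<noteq> 0" using qpos[of 0] by auto
  ultimately obtain u v where uv: "degree u \<le> k" "degree v \<le> k" "w = u * q - v * p"
    using coprime_polys_cross_image[OF cop _ deg] by blast
  \<comment> \<open>The zeros of \<open>w\<close> lie in the open interval, so the sign agreement extends by continuity to the
  end points, where the error may well be maximal.\<close>
  have we_nonneg: "0 \<le> poly w t * e t" if "t \<in> {0..1}" for t
  proof (rule continuous_ge_on_closure[where S = "{0<..<1::real}" and f = "\<lambda>t. poly w t * e t"])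
    show "0 \<le> poly w t * e t" if "t \<in> {0<..<1}" for t
    proof (cases "e t = 0")
      case False
      then have "t \<in> {0<..<1} - Z" using that Z(2) by (auto simp: e_def)
      then show ?thesis using Z'(3) unfolding w by (simp add: less_imp_le)
    qed simp
  qed (use e_cont that in \<open>auto intro!: continuous_intros\<close>)
  have we_pos: "0 < poly w t * e t" if t: "t \<in> {0..1}" and nz: "e t \<noteq> 0" for t
  proof -
    have "t \<notin> Z'" using nz Z' Z(2) unfolding e_def by auto
    then have "poly w t \<noteq> 0" using Z'(2) finZ' unfolding w by auto
    then show ?thesis using we_nonneg[OF t] nz by (metis less_eq_real_def mult_eq_0_iff)
  qed
  obtain m where m: "0 < m" "\<And>t. t \<in> {0..1} \<Longrightarrow> m \<le> poly q t"
  proof -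
    have "continuous_on {0..1} (poly q)" by (intro continuous_intros)
    then obtain t0 where "t0 \<in> {0..1}" "\<And>t. t \<in> {0..1} \<Longrightarrow> poly q t0 \<le> poly q t"
      using continuous_attains_inf[of "{0..1::real}" "poly q"] by auto
    then show thesis using that[of "poly q t0"] qpos by auto
  qed
  have bd: "\<exists>B>0. \<forall>t\<in>{0..1}. \<bar>poly x t\<bar> \<le> B" for x :: "real poly"
  proof -
    have "continuous_on {0..1} (\<lambda>t. \<bar>poly x t\<bar>)" by (intro continuous_intros)
    then obtain t0 where "t0 \<in> {0..1}" "\<And>t. t \<in> {0..1} \<Longrightarrow> \<bar>poly x t\<bar> \<le> \<bar>poly x t0\<bar>"
      using continuous_attains_sup[of "{0..1::real}" "\<lambda>t. \<bar>poly x t\<bar>"] by auto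
    then show ?thesis by (intro exI[of _ "\<bar>poly x t0\<bar> + 1"]) fastforce
  qed
  obtain V where V: "V > 0" "\<And>t. t \<in> {0..1} \<Longrightarrow> \<bar>poly v t\<bar> \<le> V" using bd[of v] by blast
  obtain W where W: "W > 0" "\<And>t. t \<in> {0..1} \<Longrightarrow> \<bar>poly w t\<bar> \<le> W" using bd[of w] by blast
  \<comment> \<open>The first bound keeps the perturbed denominator above \<open>m / 2\<close>, and with it the second one
  keeps \<open>\<eta>\<close> below \<open>E / 2\<close>.\<close>
  define \<epsilon> where "\<epsilon> = min (m / (2 * V)) (m\<^sup>2 * E / (4 * W))"
  have \<epsilon>: "0 < \<epsilon>" "\<epsilon> * V \<le> m / 2" "\<epsilon> * W \<le> m\<^sup>2 * E / 4"
    using m V W E unfolding \<epsilon>_def by (auto simp: field_simps min_def)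
  define p' where "p' = p + smult \<epsilon> u"
  define q' where "q' = q + smult \<epsilon> v"
  define \<eta> where "\<eta> t = \<epsilon> * poly w t / (poly q t * poly q' t)" for t
  have q': "m / 2 \<le> poly q' t" if t: "t \<in> {0..1}" for t
  proof -
    have "\<bar>\<epsilon> * poly v t\<bar> \<le> \<epsilon> * V" using V(2)[OF t] \<epsilon>(1) by (simp add: abs_mult)
    then show ?thesis using m(2)[OF t] \<epsilon>(2) unfolding q'_def by (simp add: abs_le_iff)
  qed
  have q'pos: "0 < poly q' t" if "t \<in> {0..1}" for t using q'[OF that] m(1) by linarith
  have err: "f t - poly p' t / poly q' t = e t - \<eta> t" if t: "t \<in> {0..1}" for t
  proof -
    have "poly p' t / poly q' t - poly p t / poly q t
        = (poly p' t * poly q t - poly p t * poly q' t) / (poly q t * poly q' t)"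
      using qpos[OF t] q'pos[OF t] by (simp add: field_simps)
    also have "poly p' t * poly q t - poly p t * poly q' t = \<epsilon> * poly w t"
      unfolding p'_def q'_def uv(3) by (simp add: algebra_simps)
    finally show ?thesis unfolding e_def \<eta>_def by simp
  qed
  have \<eta>_bd: "\<bar>\<eta> t\<bar> \<le> E / 2" if t: "t \<in> {0..1}" for t
  proof -
    have "m * (m / 2) \<le> poly q t * poly q' t"
      using m q' t qpos by (intro mult_mono) (auto simp: less_imp_le)
    moreover have "\<bar>\<epsilon> * poly w t\<bar> \<le> \<epsilon> * W" using W(2)[OF t] \<epsilon>(1) by (simp add: abs_mult)
    moreover have "0 < poly q t * poly q' t" using qpos q'pos t by simp
    ultimately have "\<bar>\<eta> t\<bar> \<le> (m\<^sup>2 * E / 4) / (m * (m / 2))"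
      unfolding \<eta>_def abs_divide using \<epsilon>(3) m(1) by (intro frac_le) auto
    also have "\<dots> = E / 2" using m(1) by (simp add: power2_eq_square field_simps)
    finally show ?thesis .
  qed
  have less: "\<bar>e t - \<eta> t\<bar> < E" if t: "t \<in> {0..1}" for t
  proof (cases "e t = 0")
    case True
    then show ?thesis using \<eta>_bd[OF t] E(1) by simp
  next
    case False
    have "e t * \<eta> t = (poly w t * e t) * (\<epsilon> / (poly q t * poly q' t))" unfolding \<eta>_def by simp
    also have "\<dots> > 0" using we_pos[OF t False] \<epsilon>(1) qpos q'pos t by simp
    finally show ?thesis
      using \<eta>_bd[OF t] E(1) E(2)[OF t] by (intro same_sign_diff_less) (auto simp: e_def)
  qed
  have "continuous_on {0..1} (\<lambda>t. \<bar>e t - \<eta> t\<bar>)"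
    unfolding \<eta>_def using e_cont qpos q'pos by (fastforce intro!: continuous_intros)
  then obtain t0 where "t0 \<in> {0..1}" "\<And>t. t \<in> {0..1} \<Longrightarrow> \<bar>e t - \<eta> t\<bar> \<le> \<bar>e t0 - \<eta> t0\<bar>"
    using continuous_attains_sup[of "{0..1::real}" "\<lambda>t. \<bar>e t - \<eta> t\<bar>"] by auto
  moreover have "degree p' \<le> k" "degree q' \<le> k"
    unfolding p'_def q'_def using deg uv
    by (auto intro!: degree_add_le order.trans[OF degree_smult_le])
  ultimately show ?thesis using less q'pos err
    by (intro exI[of _ p'] exI[of _ q'] exI[of _ "\<bar>e t0 - \<eta> t0\<bar>"]) auto
qed

section \<open>The essential supremum norm\<close>

lemma rat_eval_error_measurable:
  "(\<lambda>t. ereal \<bar>rat_eval s t - t powr \<alpha>\<bar>) \<in> borel_measurable (lebesgue_on {0..1})"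
proof -
  have [measurable]: "poly x \<in> borel_measurable borel" for x :: "real poly"
    by (intro borel_measurable_continuous_onI continuous_intros)
  have "(\<lambda>t. ereal \<bar>rat_eval s t - t powr \<alpha>\<bar>) \<in> borel_measurable borel"
    unfolding rat_eval_def by measurable
  then show ?thesis
    by (intro measurable_restrict_space1 measurable_completion) (simp add: measurable_lborel1)
qed

lemma Linfty_norm01_le:
  assumes "\<And>t. t \<in> {0..1} \<Longrightarrow> \<bar>rat_eval s t - t powr \<alpha>\<bar> \<le> E"
  shows "Linfty_norm01 (\<lambda>t. rat_eval s t - t powr \<alpha>) \<le> ereal E"
  unfolding Linfty_norm01_def
  by (intro esssup_I rat_eval_error_measurable AE_I2) (use assms in auto)

text \<open>
  An almost everywhere bound becomes an everywhere bound once it is expressed by a closed set.  The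
  finite set \<open>F\<close> absorbs the zeros of common factors and of denominators, where \<open>x / 0 = 0\<close> makes
  the values meaningless.
\<close>

lemma Linfty_norm01_le_imp_closed:
  fixes g :: "real \<Rightarrow> real"
  assumes "Linfty_norm01 g \<le> ereal E" and "finite F" and "closed C"
    and "\<And>t. t \<in> {0<..<1} \<Longrightarrow> t \<notin> F \<Longrightarrow> \<bar>g t\<bar> \<le> E \<Longrightarrow> t \<in> C"
  shows "{0..1} \<subseteq> C"
proof -
  have "AE t in lebesgue_on {0..1}. ereal \<bar>g t\<bar> \<le> ereal E"
    using esssup_AE[of "\<lambda>t. ereal \<bar>g t\<bar>" "lebesgue_on {0..1}"]
  proof eventually_elim
    case (elim t)
    then show ?case using assms(1) unfolding Linfty_norm01_def by (rule order.trans)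
  qed
  then have "AE t in lebesgue. t \<in> {0..1} \<longrightarrow> \<bar>g t\<bar> \<le> E"
    by (simp add: AE_restrict_space_iff)
  moreover have "AE t in lebesgue. t \<notin> F"
    using negligible_finite[OF assms(2)] by (intro AE_not_in) (simp add: negligible_iff_null_sets)
  ultimately have ae: "AE t \<in> {0<..<1} in lebesgue. t \<in> C"
    by eventually_elim (use assms(4) in auto)
  have "{0<..<1} \<subseteq> C"
    using mem_closed_if_AE_lebesgue_open[OF _ assms(3) ae] by auto
  then have "closure {0<..<1} \<subseteq> C" by (rule closure_minimal[OF _ assms(3)])
  then show ?thesis by simp
qed

section \<open>Interpolation of a power by rational functions\<close>

text \<open>
  The function \<open>t\<^bsup>\<alpha>\<^esup> q - p\<close> as a sum of powers.  The disjoint sum of the index sets separates the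
  exponents \<open>\<alpha> + j\<close> coming from \<open>q\<close> from the integers coming from \<open>p\<close>; the index sets may be larger
  than the degrees demand.
\<close>

lemma shifted_power_sum:
  assumes "0 < t" "finite M" "{..degree q} \<subseteq> M" "finite N" "{..degree p} \<subseteq> N"
  shows "(\<Sum>i\<in>M <+> N. case_sum (coeff q) (\<lambda>j. - coeff p j) i * t powr case_sum (\<lambda>j. \<alpha> + real j) real i)
    = t powr \<alpha> * poly q t - poly p t"
proof -
  have ext: "poly x t = (\<Sum>i\<in>K. coeff x i * t ^ i)" if "finite K" "{..degree x} \<subseteq> K" for x :: "real poly" and K
    unfolding poly_altdef
    by (rule sum.mono_neutral_left) (use that in \<open>auto simp: not_le intro!: coeff_eq_0\<close>)
  show ?thesis
    using assms
    by (simp add: sum.Plus ext[OF assms(2,3)] ext[OF assms(4,5)] powr_add powr_realpow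
        sum_negf sum_distrib_left algebra_simps)
qed

lemma shifted_exponents_inj:
  assumes "0 < \<alpha>" "\<alpha> < (1::real)"
  shows "inj_on (case_sum (\<lambda>j. \<alpha> + real j) real) I"
proof -
  have *: "\<alpha> + real i \<noteq> real j" for i j
  proof
    assume "\<alpha> + real i = real j"
    then have "real i < real j" "real j < real (Suc i)" using assms by auto
    then show False by (simp only: of_nat_less_iff)
  qed
  then have "real j \<noteq> \<alpha> + real i" for i j by metis
  with * show ?thesis by (intro inj_onI) (auto split: sum.splits)
qed

lemma interpolation_points_bound:
  fixes p q :: "real poly"
  assumes "0 < \<alpha>" "\<alpha> < 1" "q \<noteq> 0" "finite Z" "Z \<subseteq> {0<..}"
    and "\<And>z. z \<in> Z \<Longrightarrow> z powr \<alpha> * poly q z = poly p z"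
  shows "card Z \<le> degree p + degree q + 1"
proof -
  have "card Z < card ({..degree q} <+> {..degree p})"
  proof (rule power_sum_zeros_less[where r = "Inl (degree q)"])
    show "(\<Sum>i\<in>{..degree q} <+> {..degree p}. case_sum (coeff q) (\<lambda>j. - coeff p j) i *
        z powr case_sum (\<lambda>j. \<alpha> + real j) real i) = 0" if "z \<in> Z" for z
      using assms(5,6) that by (subst shifted_power_sum) auto
  qed (use assms shifted_exponents_inj in auto)
  then show ?thesis by (simp add: card_Plus)
qed

section \<open>Positivity through the Beta integral\<close>

lemma has_integral_continuous_pos:
  fixes f :: "real \<Rightarrow> real"
  assumes I: "(f has_integral I) {0<..<1}" and "continuous_on {0<..<1} f"
    and nonneg: "\<And>u. u \<in> {0<..<1} \<Longrightarrow> 0 \<le> f u" and u: "u \<in> {0<..<1}" "0 < f u"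
  shows "0 < I"
proof (rule ccontr)
  assume "\<not> 0 < I"
  define a b where "a = u / 2" and "b = (1 + u) / 2"
  have sub: "{a..b} \<subseteq> {0<..<1}" and uab: "u \<in> {a<..<b}"
    using u unfolding a_def b_def by auto
  have cont: "continuous_on (cbox a b) f" using assms(2) sub by (auto intro: continuous_on_subset)
  then obtain J where J: "(f has_integral J) (cbox a b)"
    using integrable_continuous integrable_on_def by blast
  have "J \<le> I" using has_integral_subset_le[OF _ J I] sub nonneg by auto
  moreover have "0 \<le> J" by (rule has_integral_nonneg[OF J]) (use sub nonneg in auto)
  ultimately have "J = 0" using \<open>\<not> 0 < I\<close> by simp
  then have "(f has_integral 0) (cbox a b)" using J by simp
  then have "f u = 0"
    using uab sub nonneg by (intro has_integral_0_cbox_imp_0[OF cont]) (auto simp: subset_eq)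
  then show False using u by simp
qed

lemma falling_product_shift:
  "(\<Prod>b<n. x + 1 - real b) * (x + 1 - real n) = (x + 1) * (\<Prod>b<n. x - real b)"
proof (induction n)
  case (Suc n)
  have "(\<Prod>b<Suc n. x + 1 - real b) * (x + 1 - real (Suc n))
      = ((\<Prod>b<n. x + 1 - real b) * (x + 1 - real n)) * (x - real n)" by simp
  also have "\<dots> = (x + 1) * (\<Prod>b<Suc n. x - real b)" unfolding Suc by simp
  finally show ?case .
qed simp

lemma Beta_real_pos: "0 < a \<Longrightarrow> 0 < b \<Longrightarrow> 0 < Beta a (b::real)"
  unfolding Beta_def by simp

text \<open>
  The left-hand side is the factor by which \<open>n\<close>-fold differentiation multiplies \<open>t\<^bsup>\<alpha> + m\<^esup>\<close>.
  Up to the constant, which does not depend on \<open>m\<close>, and the alternating sign it is a Beta value, because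
  both sides satisfy the same first-order recursion in \<open>m\<close>.
\<close>

lemma falling_product_eq_Beta:
  fixes \<alpha> :: real
  assumes "0 < \<alpha>" "\<alpha> < 1" "m < n"
  shows "(\<Prod>b<n. \<alpha> + real m - real b) =
    (\<Prod>b<n. \<alpha> - real b) / Beta (\<alpha> + 1) (real n - \<alpha>)
      * (-1) ^ m * Beta (\<alpha> + real m + 1) (real n - real m - \<alpha>)"
  using assms(3)
proof (induction m)
  case 0
  then have "0 < Beta (\<alpha> + 1) (real n - \<alpha>)" using assms(1,2) by (intro Beta_real_pos) auto
  then show ?case by simp
next
  case (Suc m)
  define a where "a = \<alpha> + real m + 1"
  define b where "b = real n - real (Suc m) - \<alpha>"
  define K where "K = (\<Prod>b<n. \<alpha> - real b) / Beta (\<alpha> + 1) (real n - \<alpha>)"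
  have "real (Suc m) + 1 \<le> real n" using Suc.prems by linarith
  then have ab: "0 < a" "0 < b" using assms(1,2) unfolding a_def b_def by auto
  then have ni: "a \<notin> \<int>\<^sub>\<le>\<^sub>0" "b \<notin> \<int>\<^sub>\<le>\<^sub>0" by (auto elim!: nonpos_Ints_cases)
  have "(a + b) * (b * Beta (a + 1) b) = (a + b) * (a * Beta a (b + 1))"
    using Beta_plus1_left[OF ni(1), of b] Beta_plus1_right[OF ni(2), of a] by (simp add: mult.left_commute)
  then have beta: "b * Beta (a + 1) b = a * Beta a (b + 1)" using ab by simp
  have IH: "(\<Prod>b<n. \<alpha> + real m - real b) = K * (-1) ^ m * Beta a (b + 1)"
    using Suc unfolding K_def a_def b_def by (simp add: algebra_simps)
  have "(\<Prod>b<n. \<alpha> + real (Suc m) - real b) * (- b) = a * (\<Prod>b<n. \<alpha> + real m - real b)"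
    using falling_product_shift[where n = n and x = "\<alpha> + real m"] unfolding a_def b_def by (simp add: algebra_simps)
  also have "\<dots> = K * (-1) ^ m * (b * Beta (a + 1) b)" unfolding IH beta by simp
  also have "\<dots> = (K * (-1) ^ Suc m * Beta (a + 1) b) * (- b)" by simp
  finally have "(\<Prod>b<n. \<alpha> + real (Suc m) - real b) = K * (-1) ^ Suc m * Beta (a + 1) b"
    using ab(2) by (subst (asm) mult_cancel_right) auto
  then show ?case unfolding K_def a_def b_def by (simp add: algebra_simps)
qed

lemma falling_product_sign:
  assumes "0 < \<alpha>" "\<alpha> < (1::real)"
  shows "0 < (-1) ^ n * (\<Prod>b<Suc n. \<alpha> - real b)"
proof (induction n)
  case (Suc n)
  have "(-1) ^ Suc n * (\<Prod>b<Suc (Suc n). \<alpha> - real b)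
      = ((-1) ^ n * (\<Prod>b<Suc n. \<alpha> - real b)) * (real (Suc n) - \<alpha>)"
    by (simp add: algebra_simps)
  also have "\<dots> > 0" by (rule mult_pos_pos[OF Suc]) (use assms in simp)
  finally show ?case .
qed (use assms in simp)

text \<open>
  Inserting the Beta integral turns the sum into
  \<open>\<integral> u\<^bsup>\<alpha>\<^esup> (1 - u)\<^bsup>n - 1 - \<alpha>\<^esup> g (- t u / (1 - u)) du\<close> over \<open>(0, 1)\<close>.  Hence it is positive for a
  nonzero \<open>g\<close> that is nonnegative on the negative axis.
\<close>

lemma Beta_moments_pos:
  fixes g :: "real poly"
  assumes "0 < \<alpha>" "\<alpha> < 1" "degree g < n" "g \<noteq> 0" "0 < t"
    and nonneg: "\<And>x. x < 0 \<Longrightarrow> 0 \<le> poly g x"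
  shows "0 < (\<Sum>m<n. coeff g m * (- t) ^ m * Beta (\<alpha> + real m + 1) (real n - real m - \<alpha>))"
proof -
  define F where "F u = u powr \<alpha> * (1 - u) powr (real n - 1 - \<alpha>) * poly g (- (t * u / (1 - u)))" for u
  have int: "((\<lambda>u. \<Sum>m<n. coeff g m * (- t) ^ m *
      (u powr ((\<alpha> + real m + 1) - 1) * (1 - u) powr ((real n - real m - \<alpha>) - 1))) has_integral
      (\<Sum>m<n. coeff g m * (- t) ^ m * Beta (\<alpha> + real m + 1) (real n - real m - \<alpha>))) {0<..<1}"
    (is "(?G has_integral ?S) _")
    unfolding has_integral_Icc_iff_Ioo[symmetric]
  proof (intro has_integral_sum has_integral_mult_right has_integral_Beta_real)
    fix m assume "m \<in> {..<n}"
    then have "real m + 1 \<le> real n" by auto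
    then show "0 < real n - real m - \<alpha>" using assms(2) by linarith
  qed (use assms in auto)
  have eq: "?G u = F u" if u: "u \<in> {0<..<1}" for u
  proof -
    have "poly g x = (\<Sum>m<n. coeff g m * x ^ m)" for x
      unfolding poly_altdef
      by (rule sum.mono_neutral_left) (use assms in \<open>auto simp: not_le intro!: coeff_eq_0\<close>)
    then have "F u = (\<Sum>m<n. u powr \<alpha> * (1 - u) powr (real n - 1 - \<alpha>) *
        (coeff g m * (- (t * u / (1 - u))) ^ m))"
      unfolding F_def by (simp add: sum_distrib_left)
    also have "\<dots> = ?G u"
    proof (intro sum.cong refl)
      fix m
      have "u powr (\<alpha> + real m + 1 - 1) = u powr \<alpha> * u ^ m"
        using u by (simp add: powr_add powr_realpow)
      moreover have "(1 - u) powr ((real n - real m - \<alpha>) - 1) = (1 - u) powr (real n - 1 - \<alpha>) / (1 - u) ^ m"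
      proof -
        have "(real n - real m - \<alpha>) - 1 = (real n - 1 - \<alpha>) - real m" by simp
        then show ?thesis using u by (simp only: powr_diff) (simp add: powr_realpow)
      qed
      moreover have "(- (t * u / (1 - u))) ^ m = (- t) ^ m * u ^ m / (1 - u) ^ m"
      proof -
        have "- (t * u / (1 - u)) = (- t) * u / (1 - u)" by simp
        then show ?thesis by (simp only: power_divide power_mult_distrib)
      qed
      ultimately show "u powr \<alpha> * (1 - u) powr (real n - 1 - \<alpha>) * (coeff g m * (- (t * u / (1 - u))) ^ m)
          = coeff g m * (- t) ^ m *
            (u powr (\<alpha> + real m + 1 - 1) * (1 - u) powr (real n - real m - \<alpha> - 1))"
        by (simp add: mult_ac)
    qed
    finally show ?thesis ..
  qed
  have "infinite {..<0::real}" by (rule infinite_Iio)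
  then have "\<not> {..<0} \<subseteq> {x. poly g x = 0}"
    using poly_roots_finite[OF assms(4)] finite_subset by blast
  then obtain x where x: "x < 0" "poly g x \<noteq> 0" by auto
  \<comment> \<open>The solution of \<open>- t u / (1 - u) = x\<close>.\<close>
  define u where "u = - x / (t - x)"
  have "0 < t - x" using x assms(5) by simp
  then have u: "u \<in> {0<..<1}" "t * u / (1 - u) = - x"
    using x assms(5) unfolding u_def by (auto simp: divide_simps)
  show ?thesis
  proof (rule has_integral_continuous_pos)
    show "(F has_integral ?S) {0<..<1}"
      using int eq by (subst has_integral_cong[symmetric]) auto
    show "continuous_on {0<..<1} F"
      unfolding F_def by (intro continuous_intros) auto
    show "0 \<le> F v" if "v \<in> {0<..<1}" for v
      using that assms(5) nonneg[of "- (t * v / (1 - v))"] unfolding F_def by simp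
    have "0 < poly g x" using nonneg[OF x(1)] x(2) by simp
    then show "0 < F u" using u unfolding F_def by simp
  qed (fact u(1))
qed

text \<open>
  The functions \<open>E j\<close> are \<open>t\<^bsup>j\<^esup>\<close> times the \<open>j\<close>-th derivative of \<open>R / (t - d)\<close>.
\<close>

lemma simple_pole_euler_step:
  fixes d R t :: real
  assumes "d < 0" "0 < t"
  defines "E \<equiv> \<lambda>j t. R * (-1) ^ j * fact j * (t ^ j / (t - d) ^ Suc j)"
  shows "\<exists>D'. (E j has_real_derivative D') (at t) \<and> E (Suc j) t = t * D' - real j * E j t"
proof -
  define C where "C = R * (-1) ^ j * fact j"
  define y where "y = t - d"
  define T' where "T' = real j * t ^ (j - Suc 0)"
  define Q where "Q = (T' * y ^ Suc j - t ^ j * (real (Suc j) * y ^ j)) / (y ^ Suc j * y ^ Suc j)"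
  have nz: "y \<noteq> 0" using assms(1,2) unfolding y_def by simp
  have d1: "((\<lambda>t. t ^ j) has_real_derivative T') (at t)"
    unfolding T'_def by (rule DERIV_pow)
  have d2: "((\<lambda>t. (t - d) ^ Suc j) has_real_derivative real (Suc j) * y ^ j) (at t)"
    unfolding y_def by (rule derivative_eq_intros refl)+ simp
  have "(E j has_real_derivative C * Q) (at t)"
    unfolding E_def Q_def C_def y_def
    by (intro DERIV_cmult DERIV_divide d1 d2[unfolded y_def]) (use nz in \<open>simp add: y_def\<close>)
  moreover have "E (Suc j) t = t * (C * Q) - real j * E j t"
  proof -
    have "t * T' = real j * t ^ j" unfolding T'_def by (cases j) auto
    have "t * Q = (t * T' * (y * y ^ j) - t * t ^ j * (real (Suc j) * y ^ j)) / ((y * y ^ j) * (y * y ^ j))"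
      unfolding Q_def by (simp add: algebra_simps)
    also have "\<dots> = t * T' / (y * y ^ j) - t * t ^ j * real (Suc j) / (y * (y * y ^ j))"
      using nz by (simp add: diff_divide_distrib)
    finally have tQ: "t * Q = real j * (t ^ j / y ^ Suc j) - real (Suc j) * (t ^ Suc j / y ^ Suc (Suc j))"
      unfolding \<open>t * T' = _\<close> by (simp add: mult_ac)
    have "t * (C * Q) - real j * E j t = C * (t * Q - real j * (t ^ j / y ^ Suc j))"
      unfolding E_def C_def y_def[symmetric] by (simp only: right_diff_distrib mult_ac)
    also have "\<dots> = - C * real (Suc j) * (t ^ Suc j / y ^ Suc (Suc j))"
      unfolding tQ by (simp add: algebra_simps del: power_Suc of_nat_Suc)
    also have "- C * real (Suc j) = R * (-1) ^ Suc j * fact (Suc j)"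
      unfolding C_def by (simp add: mult_ac)
    finally show ?thesis unfolding E_def y_def[symmetric] by simp
  qed
  ultimately show ?thesis by blast
qed

text \<open>
  This is the substitute for the integral representation of \<open>t\<^bsup>\<alpha>\<^esup>\<close> as a Stieltjes function.  The
  difference of the two sides of the interpolation condition has \<open>2 k + 1\<close> zeros, so its derivative of
  order \<open>2 k\<close> vanishes at some \<open>t > 0\<close>.  That derivative kills \<open>h\<close>, gives \<open>R / (z - d)\<close> a
  positive multiple of \<open>R\<close>, and turns \<open>z\<^bsup>\<alpha>\<^esup> g\<close> into a negative multiple of the positive integral
  above; the parity of the order decides both signs.
\<close>

lemma residue_negative:
  fixes g h :: "real poly"
  assumes \<alpha>: "0 < \<alpha>" "\<alpha> < 1" and deg: "degree g < 2 * k" "degree h < 2 * k" and "g \<noteq> 0"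
    and nonneg: "\<And>x. x < 0 \<Longrightarrow> 0 \<le> poly g x" and "d < 0"
    and Z: "finite Z" "Z \<subseteq> {0<..}" "card Z = Suc (2 * k)"
    and eq: "\<And>z. z \<in> Z \<Longrightarrow> z powr \<alpha> * poly g z = poly h z + R / (z - d)"
  shows "R < 0"
proof -
  define n where "n = 2 * k"
  define c where "c = case_sum (coeff g) (\<lambda>j. - coeff h j)"
  define a where "a = case_sum (\<lambda>j. \<alpha> + real j) real"
  define I where "I = {..<n} <+> {..<n}"
  define E where "E j t = R * (-1) ^ j * fact j * (t ^ j / (t - d) ^ Suc j)" for j t
  define D where "D j t = (\<Sum>i\<in>I. c i * (\<Prod>l<j. a i - real l) * t powr a i) - E j t" for j t
  have "\<exists>z>0. D n z = 0"
  proof (rule rolle_chain[where b = real and Z = Z])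
    fix j :: nat and t :: real assume t: "0 < t"
    obtain D1 where D1: "((\<lambda>t. \<Sum>i\<in>I. c i * (\<Prod>l<j. a i - real l) * t powr a i) has_real_derivative D1) (at t)"
      "(\<Sum>i\<in>I. c i * (\<Prod>l<Suc j. a i - real l) * t powr a i)
        = t * D1 - real j * (\<Sum>i\<in>I. c i * (\<Prod>l<j. a i - real l) * t powr a i)"
      using power_sum_euler_step[OF t, where I = I and c = c and j = j and a = a and b = real] by blast
    obtain D2 where D2: "(E j has_real_derivative D2) (at t)" "E (Suc j) t = t * D2 - real j * E j t"
      using simple_pole_euler_step[OF assms(7) t] unfolding E_def by blast
    show "\<exists>D'. (D j has_real_derivative D') (at t) \<and> D (Suc j) t = t * D' - real j * D j t"
    proof (intro exI conjI)
      show "(D j has_real_derivative D1 - D2) (at t)"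
        unfolding D_def using D1(1) D2(1) by (rule DERIV_diff)
      show "D (Suc j) t = t * (D1 - D2) - real j * D j t"
        unfolding D_def D1(2) D2(2) by (simp add: algebra_simps)
    qed
  next
    fix z assume z: "z \<in> Z"
    then have "0 < z" using Z(2) by auto
    have "(\<Sum>i\<in>I. c i * z powr a i) = z powr \<alpha> * poly g z - poly h z"
      unfolding I_def c_def a_def
      by (rule shifted_power_sum) (use deg \<open>0 < z\<close> in \<open>auto simp: n_def\<close>)
    then show "D 0 z = 0" using eq[OF z] unfolding D_def E_def by simp
  qed (use Z in \<open>auto simp: n_def\<close>)
  then obtain t where t: "0 < t" "D n t = 0" by blast
  \<comment> \<open>The factor \<open>K\<close> is negative because \<open>n\<close> is even: of the factors \<open>\<alpha> - b\<close> only the first is positive.\<close>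
  define K where "K = (\<Prod>b<n. \<alpha> - real b) / Beta (\<alpha> + 1) (real n - \<alpha>)"
  define S where "S = (\<Sum>m<n. coeff g m * (- t) ^ m * Beta (\<alpha> + real m + 1) (real n - real m - \<alpha>))"
  obtain n' where n': "n = Suc n'" "odd n'" using deg(1) unfolding n_def
    by (cases "2 * k") (auto, metis even_Suc even_mult_iff even_numeral)
  have zero: "(\<Prod>l<n. real m - real l) = 0" if "m < n" for m
    using that by (intro prod_zero) auto
  have "(\<Sum>i\<in>I. c i * (\<Prod>l<n. a i - real l) * t powr a i)
      = (\<Sum>m<n. coeff g m * (\<Prod>l<n. \<alpha> + real m - real l) * t powr (\<alpha> + real m))"
    unfolding I_def c_def a_def by (simp add: sum.Plus zero)
  also have "\<dots> = (\<Sum>m<n. K * t powr \<alpha> *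
      (coeff g m * (- t) ^ m * Beta (\<alpha> + real m + 1) (real n - real m - \<alpha>)))"
  proof (intro sum.cong refl)
    fix m assume "m \<in> {..<n}"
    then have P: "(\<Prod>l<n. \<alpha> + real m - real l)
        = K * (-1) ^ m * Beta (\<alpha> + real m + 1) (real n - real m - \<alpha>)"
      using falling_product_eq_Beta[OF \<alpha>, of m n] unfolding K_def by simp
    have "(- t) ^ m = (-1) ^ m * t ^ m" by (rule power_minus)
    then show "coeff g m * (\<Prod>l<n. \<alpha> + real m - real l) * t powr (\<alpha> + real m)
        = K * t powr \<alpha> * (coeff g m * (- t) ^ m * Beta (\<alpha> + real m + 1) (real n - real m - \<alpha>))"
      unfolding P using t(1) by (simp add: powr_add powr_realpow mult_ac)
  qed
  also have "\<dots> = K * t powr \<alpha> * S" unfolding S_def by (simp add: sum_distrib_left)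
  finally have "E n t = K * t powr \<alpha> * S" using t(2) unfolding D_def by simp
  then have balance: "R * (fact n * (t ^ n / (t - d) ^ Suc n)) = K * (t powr \<alpha> * S)"
    unfolding E_def n_def by simp
  have "0 < S"
    unfolding S_def
    by (rule Beta_moments_pos[OF \<alpha> deg(1)[folded n_def] assms(5) t(1) nonneg])
  then have "0 < t powr \<alpha> * S" using t(1) by simp
  moreover have "K < 0"
  proof -
    have "(\<Prod>b<n. \<alpha> - real b) < 0"
      using falling_product_sign[OF \<alpha>, of n'] n' by simp
    moreover have "0 < Beta (\<alpha> + 1) (real n - \<alpha>)" using \<alpha> n' by (intro Beta_real_pos) auto
    ultimately show ?thesis unfolding K_def by (simp add: divide_neg_pos)
  qed
  ultimately have "R * (fact n * (t ^ n / (t - d) ^ Suc n)) < 0"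
    unfolding balance by (simp add: mult_neg_pos)
  moreover have "0 < fact n * (t ^ n / (t - d) ^ Suc n)" using t(1) assms(7) by simp
  ultimately show ?thesis by (meson mult_less_0_iff order_less_asym)
qed

section \<open>Negative poles and positive partial fractions of the interpolant\<close>

lemma poly_linear_factor_prod_degree:
  fixes D :: "real set"
  shows "degree (\<Prod>d\<in>D. [:1, - 1 / d:]) \<le> card D"
proof (cases "finite D")
  case True
  then have "degree (\<Prod>d\<in>D. [:1, - 1 / d:]) \<le> sum (degree \<circ> (\<lambda>d. [:1, - 1 / d:])) D"
    by (rule degree_prod_sum_le)
  also have "\<dots> \<le> (\<Sum>d\<in>D. 1)" by (rule sum_mono) simp
  finally show ?thesis by simp
qed simp

text \<open>
  If \<open>q\<close> had fewer than \<open>k\<close> negative roots, a polynomial \<open>s\<close> of degree less than \<open>k\<close> would make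
  \<open>q s\<close> nonnegative on the negative axis.  Multiplying the interpolation condition by \<open>s\<close> then
  contradicts the sign of the residue, which is \<open>0\<close> here.  So \<open>q\<close>, being \<open>1\<close> at \<open>0\<close>, is the product
  of its normalized linear factors at \<open>k\<close> distinct negative roots.
\<close>

lemma interpolant_denominator_factors:
  fixes p q :: "real poly"
  assumes \<alpha>: "0 < \<alpha>" "\<alpha> < 1" and k: "0 < k" and deg: "degree p \<le> k" "degree q \<le> k"
    and q0: "poly q 0 = 1"
    and Z: "finite Z" "Z \<subseteq> {0<..}" "card Z = Suc (2 * k)"
    and eq: "\<And>z. z \<in> Z \<Longrightarrow> z powr \<alpha> * poly q z = poly p z"
  shows "\<exists>D. finite D \<and> card D = k \<and> D \<subseteq> {..<0} \<and> q = (\<Prod>d\<in>D. [:1, - 1 / d:])"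
proof -
  define D where "D = {t \<in> {..<0}. poly q t = 0}"
  have "q \<noteq> 0" using q0 by auto
  then have fin: "finite D" unfolding D_def using poly_roots_finite[of q] by auto
  have "card D \<le> card {t. poly q t = 0}"
    using \<open>q \<noteq> 0\<close> unfolding D_def by (intro card_mono poly_roots_finite) auto
  then have "card D \<le> k" using card_poly_roots_bound[OF \<open>q \<noteq> 0\<close>] deg(2) by linarith
  have "k \<le> card D"
  proof (rule ccontr)
    assume "\<not> k \<le> card D"
    obtain D' \<sigma> where D': "D' \<subseteq> D" "\<sigma> = 1 \<or> \<sigma> = (-1::real)"
      "\<forall>t\<in>{..<0} - D. 0 < \<sigma> * (\<Prod>z\<in>D'. t - z) * poly q t"
    proof -
      have "is_interval {..<0::real}" by (simp add: is_interval_1)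
      moreover have "continuous_on {..<0} (poly q)" by (intro continuous_intros)
      ultimately show thesis
        using that sign_matching_product[of "{..<0}" "poly q" D] fin D_def by blast
    qed
    define s where "s = smult \<sigma> (\<Prod>z\<in>D'. [:- z, 1:])"
    have s: "poly s t = \<sigma> * (\<Prod>z\<in>D'. t - z)" for t
      unfolding s_def by (simp add: poly_prod)
    have finD': "finite D'" using D'(1) fin finite_subset by blast
    have "degree s \<le> card D'"
      unfolding s_def using degree_prod_sum_le[OF finD', of "\<lambda>z. [:- z, 1:]"] by simp
    then have degs: "degree s < k"
      using card_mono[OF fin D'(1)] \<open>\<not> k \<le> card D\<close> by linarith
    have "s \<noteq> 0" using D'(2) finD' unfolding s_def by auto
    have "(0::real) < 0"
    proof (rule residue_negative[OF \<alpha>, where k = k and g = "q * s" and h = "p * s" and d = "-1" and Z = Z])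
      show "degree (q * s) < 2 * k" using degree_mult_le[of q s] degs deg by linarith
      show "degree (p * s) < 2 * k" using degree_mult_le[of p s] degs deg by linarith
      show "q * s \<noteq> 0" using \<open>q \<noteq> 0\<close> \<open>s \<noteq> 0\<close> by simp
      show "0 \<le> poly (q * s) x" if "x < 0" for x
      proof (cases "x \<in> D")
        case False
        then have "0 < poly s x * poly q x" using D'(3) that unfolding s by auto
        then show ?thesis by (simp add: mult.commute)
      qed (simp add: D_def)
      show "z powr \<alpha> * poly (q * s) z = poly (p * s) z + 0 / (z - - 1)" if "z \<in> Z" for z
        using eq[OF that] by (simp add: mult.assoc[symmetric])
    qed (use Z in auto)
    then show False by simp
  qed
  with \<open>card D \<le> k\<close> have card: "card D = k" by simp
  have neg: "D \<subseteq> {..<0}" unfolding D_def by auto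
  have "q = (\<Prod>d\<in>D. [:1, - 1 / d:])"
  proof (rule poly_eqI_degree[where A = "insert 0 D"])
    fix x assume "x \<in> insert 0 D"
    then consider "x = 0" | "x \<in> D" by auto
    then show "poly q x = poly (\<Prod>d\<in>D. [:1, - 1 / d:]) x"
    proof cases
      case 2
      then have "(\<Prod>d\<in>D. 1 + x * (- 1 / d)) = 0"
        using fin neg by (intro prod_zero) (auto intro!: bexI[of _ x])
      with 2 show ?thesis by (simp add: poly_prod D_def)
    qed (simp add: poly_prod q0)
  next
    have "card (insert 0 D) = Suc k" using neg fin card by (subst card_insert_disjoint) auto
    then show "degree q < card (insert 0 D)" "degree (\<Prod>d\<in>D. [:1, - 1 / d:]) < card (insert 0 D)"
      using card deg(2) poly_linear_factor_prod_degree[of D] by linarith+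
  qed
  with fin card neg show ?thesis by blast
qed

text \<open>
  The residue of \<open>p/q\<close> at a root \<open>d\<close> of \<open>q\<close> has a definite sign: multiplying the interpolation
  condition by \<open>q / (1 - t/d)\<^sup>2\<close> leaves the square of a polynomial as the factor of \<open>z\<^bsup>\<alpha>\<^esup>\<close>,
  and a single pole at \<open>d\<close> on the other side.  Written with the basis functions \<open>t / (1 - t/d)\<close>
  instead of \<open>1 / (t - d)\<close>, the expansion has the constant term \<open>p(0)\<close>, which is nonnegative by the
  rule of signs, and positive coefficients \<open>e d\<close>.
\<close>

lemma interpolant_partial_fractions:
  fixes p q :: "real poly"
  assumes \<alpha>: "0 < \<alpha>" "\<alpha> < 1" and k: "0 < k" and deg: "degree p \<le> k" "degree q \<le> k"
    and q0: "poly q 0 = 1"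
    and Z: "finite Z" "Z \<subseteq> {0<..}" "card Z = Suc (2 * k)"
    and eq: "\<And>z. z \<in> Z \<Longrightarrow> z powr \<alpha> * poly q z = poly p z"
  shows "\<exists>D c e. finite D \<and> D \<subseteq> {..<0} \<and> 0 \<le> c \<and> (\<forall>d\<in>D. 0 < e d) \<and>
    q = (\<Prod>d\<in>D. [:1, - 1 / d:]) \<and>
    p = smult c q + (\<Sum>d\<in>D. smult (e d) ([:0, 1:] * (\<Prod>d'\<in>D - {d}. [:1, - 1 / d':])))"
proof -
  obtain D where D: "finite D" "card D = k" "D \<subseteq> {..<0}" "q = (\<Prod>d\<in>D. [:1, - 1 / d:])"
    using interpolant_denominator_factors[OF assms] by blast
  define Q where "Q d = (\<Prod>d'\<in>D - {d}. [:1, - 1 / d':])" for d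
  define e where "e d = poly p d / (d * poly (Q d) d)" for d
  have qQ: "q = [:1, - 1 / d:] * Q d" if "d \<in> D" for d
    unfolding D(4) Q_def using D(1) that by (subst prod.remove[of _ d]) auto
  have degQ: "degree (Q d) \<le> k - 1" if "d \<in> D" for d
    unfolding Q_def using poly_linear_factor_prod_degree[of "D - {d}"] D(1,2) that by simp
  have Q_nz: "poly (Q d) d \<noteq> 0" if "d \<in> D" for d
    unfolding Q_def poly_prod using D(1,3) that by (auto simp: field_simps)
  have Q_z: "poly (Q d) x = 0" if "x \<in> D" "x \<noteq> d" for d x
    unfolding Q_def poly_prod using D(1,3) that by (intro prod_zero) (auto intro!: bexI[of _ x])
  have e_pos: "0 < e d" if d: "d \<in> D" for d
  proof -
    have "d < 0" using D(3) d by auto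
    \<comment> \<open>Remainder and quotient of the division of \<open>p * Q d\<close> by \<open>t - d\<close>, scaled by \<open>- d\<close> since
    \<open>1 - t/d = (t - d) / (- d)\<close>.\<close>
    define R where "R = - d * (poly p d * poly (Q d) d)"
    define h where "h = smult (- d) (synthetic_div (p * Q d) d)"
    have "R < 0"
    proof (rule residue_negative[OF \<alpha>, where k = k and g = "Q d * Q d" and h = h and d = d and Z = Z])
      show "degree (Q d * Q d) < 2 * k"
        using degree_mult_le[of "Q d" "Q d"] degQ[OF d] k by linarith
      have "degree (p * Q d) < 2 * k"
        using degree_mult_le[of p "Q d"] degQ[OF d] deg(1) k by linarith
      then show "degree h < 2 * k" unfolding h_def by (auto simp: degree_synthetic_div)
      show "Q d * Q d \<noteq> 0" using Q_nz[OF d] by auto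
      show "z powr \<alpha> * poly (Q d * Q d) z = poly h z + R / (z - d)" if z: "z \<in> Z" for z
      proof -
        have "z - d \<noteq> 0" using z Z(2) \<open>d < 0\<close> by auto
        have "poly (p * Q d) z = (z - d) * poly (synthetic_div (p * Q d) d) z + poly (p * Q d) d"
          using arg_cong[OF synthetic_div_correct'[of d "p * Q d"], of "\<lambda>x. poly x z"]
          by (simp add: algebra_simps)
        then have "poly (p * Q d) z / (z - d)
            = poly (synthetic_div (p * Q d) d) z + poly (p * Q d) d / (z - d)"
          using \<open>z - d \<noteq> 0\<close> by (simp add: add_divide_distrib)
        then have "- d * (poly (p * Q d) z / (z - d))
            = - d * poly (synthetic_div (p * Q d) d) z + - d * (poly (p * Q d) d / (z - d))"
          by (simp only: distrib_left)
        then have 1: "poly h z + R / (z - d) = - d * (poly p z * poly (Q d) z) / (z - d)"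
          unfolding h_def R_def by simp
        have "poly q z = (1 - z / d) * poly (Q d) z"
          using arg_cong[OF qQ[OF d], of "\<lambda>x. poly x z"] by (simp add: algebra_simps)
        then have "poly p z = (z powr \<alpha> * poly (Q d) z) * (1 - z / d)"
          using eq[OF z] by (simp only: ac_simps)
        also have "1 - z / d = (z - d) / (- d)" using \<open>d < 0\<close> by (simp add: field_simps)
        finally show ?thesis unfolding 1 using \<open>d < 0\<close> \<open>z - d \<noteq> 0\<close> by simp
      qed
    qed (use Z \<open>d < 0\<close> in auto)
    then have "poly p d * poly (Q d) d < 0"
      unfolding R_def using \<open>d < 0\<close> by (auto simp: zero_less_mult_iff mult_less_0_iff)
    then consider "0 < poly p d" "poly (Q d) d < 0" | "poly p d < 0" "0 < poly (Q d) d"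
      by (auto simp: mult_less_0_iff)
    then show ?thesis unfolding e_def using \<open>d < 0\<close>
      by cases (simp_all add: divide_neg_neg mult_neg_neg mult_neg_pos)
  qed
  have c: "0 \<le> poly p 0"
  proof -
    have "case_sum (coeff q) (\<lambda>j. - coeff p j) (Inr 0) * case_sum (coeff q) (\<lambda>j. - coeff p j) (Inl 0) \<le> 0"
    proof (rule power_sum_lowest_signs[where I = "{..k} <+> {..k}" and Z = Z])
      show "inj_on (case_sum (\<lambda>j. \<alpha> + real j) real) ({..k} <+> {..k})"
        by (rule shifted_exponents_inj[OF \<alpha>])
      show "(\<Sum>i\<in>{..k} <+> {..k}. case_sum (coeff q) (\<lambda>j. - coeff p j) i *
        z powr case_sum (\<lambda>j. \<alpha> + real j) real i) = 0" if "z \<in> Z" for z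
        using Z(2) eq that deg by (subst shifted_power_sum) auto
    next
      fix i :: "nat + nat"
      assume "i \<noteq> Inr 0" "i \<noteq> Inl 0"
      then obtain j where "i = Inl (Suc j) \<or> i = Inr (Suc j)"
        by (metis not0_implies_Suc sum.exhaust)
      then show "case_sum (\<lambda>j. \<alpha> + real j) real (Inr 0) < case_sum (\<lambda>j. \<alpha> + real j) real i \<and>
          case_sum (\<lambda>j. \<alpha> + real j) real (Inl 0) < case_sum (\<lambda>j. \<alpha> + real j) real i"
        using \<alpha> by auto
    qed (use Z in \<open>auto simp: card_Plus\<close>)
    then show ?thesis using q0 by (simp add: poly_0_coeff_0)
  qed
  have "p = smult (poly p 0) q + (\<Sum>d\<in>D. smult (e d) ([:0, 1:] * Q d))"
  proof (rule poly_eqI_degree[where A = "insert 0 D"])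
    fix x assume "x \<in> insert 0 D"
    then consider "x = 0" | "x \<in> D" by auto
    then show "poly p x = poly (smult (poly p 0) q + (\<Sum>d\<in>D. smult (e d) ([:0, 1:] * Q d))) x"
    proof cases
      case 1
      then show ?thesis by (simp add: poly_sum q0)
    next
      case 2
      have "poly q x = 0" using 2 D(3) arg_cong[OF qQ[OF 2], of "\<lambda>y. poly y x"] by auto
      moreover have "(\<Sum>d\<in>D. e d * (x * poly (Q d) x)) = e x * (x * poly (Q x) x)"
        using D(1) 2 Q_z by (subst sum.remove[of _ x]) (auto intro!: sum.neutral)
      moreover have "e x * (x * poly (Q x) x) = poly p x"
        using Q_nz[OF 2] D(3) 2 unfolding e_def by auto
      ultimately show ?thesis by (simp add: poly_sum mult.left_commute)
    qed
  next
    have "0 \<notin> D" using D(3) by auto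
    then have card: "card (insert 0 D) = Suc k" using D by simp
    show "degree p < card (insert 0 D)" using card deg by simp
    have "degree (smult (e d) ([:0, 1:] * Q d)) \<le> k" if "d \<in> D" for d
      using degree_smult_le[of "e d" "[:0, 1:] * Q d"] degree_mult_le[of "[:0, 1:]" "Q d"] degQ[OF that] k
      by (auto simp del: degree_smult_eq)
    then have "degree (smult (poly p 0) q + (\<Sum>d\<in>D. smult (e d) ([:0, 1:] * Q d))) \<le> k"
      using deg D(1) by (intro degree_add_le degree_sum_le) (auto intro: order.trans[OF degree_smult_le])
    then show "degree (smult (poly p 0) q + (\<Sum>d\<in>D. smult (e d) ([:0, 1:] * Q d))) < card (insert 0 D)"
      unfolding card by simp
  qed
  with D c e_pos show ?thesis unfolding Q_def by (intro exI[of _ D] exI[of _ "poly p 0"] exI[of _ e]) blast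
qed

section \<open>The best approximation interpolates at many points\<close>

text \<open>
  Comparison with the zero function bounds the error by \<open>1\<close>, hence \<open>\<bar>p\<bar> \<le> 2 \<bar>q\<bar>\<close> on \<open>[0, 1]\<close> for
  the reduced fraction \<open>p/q\<close>.  A zero of \<open>q\<close> there would be a common zero of \<open>p\<close> and \<open>q\<close>.
\<close>

lemma BURA_coprime_representation:
  assumes \<alpha>: "0 < \<alpha>" and "is_BURA \<alpha> k r"
  shows "\<exists>p q g. fst r = p * g \<and> snd r = q * g \<and> coprime p q \<and> (\<forall>t\<in>{0..1}. 0 < poly q t)"
proof -
  define P Q where "P = fst r" and "Q = snd r"
  have "poly Q 0 = 1"
    using assms(2) unfolding is_BURA_def rational_funs_def Q_def by auto
  then have "Q \<noteq> 0" by auto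
  then have "gcd P Q \<noteq> 0" by simp
  then obtain p q where pq: "P = p * gcd P Q" "Q = q * gcd P Q" "coprime p q"
    using gcd_coprime_exists by blast
  have "(0, 1) \<in> rational_funs k" unfolding rational_funs_def by simp
  then have "Linfty_norm01 (\<lambda>t. rat_eval r t - t powr \<alpha>) \<le> Linfty_norm01 (\<lambda>t. rat_eval (0, 1) t - t powr \<alpha>)"
    using assms(2) unfolding is_BURA_def by blast
  also have "\<dots> \<le> ereal 1"
    using \<alpha> by (intro Linfty_norm01_le) (auto simp: rat_eval_def intro: powr_le1)
  finally have norm: "Linfty_norm01 (\<lambda>t. rat_eval r t - t powr \<alpha>) \<le> ereal 1" .
  have "{0..1} \<subseteq> {t. \<bar>poly p t\<bar> \<le> 2 * \<bar>poly q t\<bar>}"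
  proof (rule Linfty_norm01_le_imp_closed[OF norm])
    show "finite {t. poly Q t = 0}" using \<open>Q \<noteq> 0\<close> by (rule poly_roots_finite)
    show "closed {t. \<bar>poly p t\<bar> \<le> 2 * \<bar>poly q t\<bar>}" by (intro closed_Collect_le continuous_intros)
    fix t assume t: "t \<in> {0<..<1::real}" "t \<notin> {t. poly Q t = 0}" "\<bar>rat_eval r t - t powr \<alpha>\<bar> \<le> 1"
    have Qt: "poly Q t = poly q t * poly (gcd P Q) t" and Pt: "poly P t = poly p t * poly (gcd P Q) t"
      by (metis pq(2) poly_mult) (metis pq(1) poly_mult)
    have nz: "poly q t \<noteq> 0" "poly (gcd P Q) t \<noteq> 0" using t(2) Qt by auto
    have "rat_eval r t = poly p t / poly q t"
      using nz(2) unfolding rat_eval_def P_def[symmetric] Q_def[symmetric] Pt Qt by simp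
    moreover have "0 \<le> t powr \<alpha>" "t powr \<alpha> \<le> 1" using t(1) \<alpha> by (auto intro: powr_le1)
    ultimately have "\<bar>poly p t / poly q t\<bar> \<le> 2" using t(3) by (simp only: abs_le_iff) linarith
    then show "t \<in> {t. \<bar>poly p t\<bar> \<le> 2 * \<bar>poly q t\<bar>}"
      using nz(1) by (simp add: abs_divide divide_le_eq)
  qed
  then have bound: "\<bar>poly p t\<bar> \<le> 2 * \<bar>poly q t\<bar>" if "t \<in> {0..1}" for t using that by auto
  have q_nz: "poly q t \<noteq> 0" if "t \<in> {0..1}" for t
  proof
    assume "poly q t = 0"
    then have "poly p t = 0" using bound[OF that] by simp
    obtain a b where "a * p + b * q = 1" using coprime_polys_bezout[OF pq(3)] .
    then have "poly (a * p + b * q) t = 1" by simp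
    with \<open>poly q t = 0\<close> \<open>poly p t = 0\<close> show False by simp
  qed
  have "continuous_on {0..1} (poly q)" by (intro continuous_intros)
  then obtain \<sigma> :: real where \<sigma>: "\<sigma> = 1 \<or> \<sigma> = -1" "\<And>t. t \<in> {0..1} \<Longrightarrow> 0 < \<sigma> * poly q t"
    using nonvanishing_constant_sign[of "{0..1}" "poly q"] q_nz by (metis is_interval_cc)
  from \<sigma>(1) show ?thesis
  proof
    assume "\<sigma> = 1"
    then show ?thesis using pq \<sigma>(2) unfolding P_def Q_def by fastforce
  next
    assume "\<sigma> = -1"
    then have "P = (- p) * (- gcd P Q)" "Q = (- q) * (- gcd P Q)" "\<And>t. t \<in> {0..1} \<Longrightarrow> 0 < poly (- q) t"
      using pq \<sigma>(2) by simp_all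
    moreover have "coprime (- p) (- q)" using pq(3) by simp
    ultimately show ?thesis unfolding P_def Q_def by blast
  qed
qed

text \<open>
  Write \<open>m\<close> and \<open>n\<close> for the degrees of the reduced numerator and denominator.  The error must
  have more than \<open>k + max m n\<close> zeros in \<open>(0, 1)\<close>, for otherwise it could be improved; as a sum of
  \<open>m + n + 2\<close> powers divided by \<open>q\<close> it has at most \<open>m + n + 1\<close>.  Both are possible only if
  \<open>m = n = k\<close>, so the best approximation is not degenerate and interpolates at \<open>2 k + 1\<close> points.
\<close>

lemma BURA_interpolates:
  assumes \<alpha>: "0 < \<alpha>" "\<alpha> < 1" and BURA: "is_BURA \<alpha> k r"
  shows "\<exists>Z. finite Z \<and> Z \<subseteq> {0<..} \<and> card Z = Suc (2 * k) \<and>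
    (\<forall>z\<in>Z. z powr \<alpha> * poly (snd r) z = poly (fst r) z)"
proof -
  obtain p q g where pqg: "fst r = p * g" "snd r = q * g" "coprime p q"
    "\<And>t. t \<in> {0..1} \<Longrightarrow> 0 < poly q t"
    using BURA_coprime_representation[OF \<alpha>(1) BURA] by blast
  have R: "degree (p * g) \<le> k" "degree (q * g) \<le> k" "poly (q * g) 0 = 1"
    using BURA pqg(1,2) unfolding is_BURA_def rational_funs_def by auto
  have "g \<noteq> 0" "q \<noteq> 0" using R(3) by auto
  have deg: "degree p \<le> k" "degree q \<le> k"
    using R(1,2) \<open>g \<noteq> 0\<close> \<open>q \<noteq> 0\<close> by (cases "p = 0"; simp add: degree_mult_eq)+
  define e where "e t = t powr \<alpha> - poly p t / poly q t" for t
  have pow: "continuous_on {0..1} (\<lambda>t. t powr \<alpha>)"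
    using \<alpha>(1) by (intro continuous_on_powr' continuous_intros) auto
  have cont: "continuous_on {0..1} (\<lambda>t. \<bar>e t\<bar>)"
    unfolding e_def using pow pqg(4) by (fastforce intro!: continuous_intros)
  obtain t0 where t0: "t0 \<in> {0..1}" "\<And>t. t \<in> {0..1} \<Longrightarrow> \<bar>e t\<bar> \<le> \<bar>e t0\<bar>"
    using continuous_attains_sup[OF _ _ cont] by auto
  define Z where "Z = {t \<in> {0<..<1}. e t = 0}"
  have Z_eq: "z powr \<alpha> * poly q z = poly p z" if "z \<in> Z" for z
    using that pqg(4)[of z] unfolding Z_def e_def by (auto simp: field_simps)
  have few: "card Y \<le> degree p + degree q + 1" if "finite Y" "Y \<subseteq> Z" for Y
    using that Z_eq by (intro interpolation_points_bound[OF \<alpha> \<open>q \<noteq> 0\<close>]) (auto simp: Z_def)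
  have finZ: "finite Z"
  proof (rule ccontr)
    assume "infinite Z"
    then obtain Y where "finite Y" "card Y = degree p + degree q + 2" "Y \<subseteq> Z"
      using infinite_arbitrarily_large by blast
    then show False using few[of Y] by simp
  qed
  have "e t0 \<noteq> 0"
  proof
    assume "e t0 = 0"
    then have "Z = {0<..<1}" using t0(2) unfolding Z_def by force
    then show False using finZ infinite_Ioo[of "0::real" 1] by simp
  qed
  have many: "k + max (degree p) (degree q) < card Z"
  proof (rule ccontr)
    assume "\<not> k + max (degree p) (degree q) < card Z"
    then have "\<exists>p' q' E'. degree p' \<le> k \<and> degree q' \<le> k \<and> E' < \<bar>e t0\<bar> \<and>
      (\<forall>t\<in>{0..1}. 0 < poly q' t \<and> \<bar>t powr \<alpha> - poly p' t / poly q' t\<bar> \<le> E')"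
      using t0 \<open>e t0 \<noteq> 0\<close> finZ
      by (intro improved_rational_approximation[OF pqg(3) deg pqg(4) pow, where Z = Z]) (auto simp: Z_def e_def)
    then obtain p' q' E' where better: "degree p' \<le> k" "degree q' \<le> k" "E' < \<bar>e t0\<bar>"
      "\<And>t. t \<in> {0..1} \<Longrightarrow> 0 < poly q' t"
      "\<And>t. t \<in> {0..1} \<Longrightarrow> \<bar>t powr \<alpha> - poly p' t / poly q' t\<bar> \<le> E'"
      by blast
    \<comment> \<open>Rescaled to the normalization \<open>Q(0) = 1\<close>.\<close>
    define s where "s = (smult (1 / poly q' 0) p', smult (1 / poly q' 0) q')"
    have q'0: "0 < poly q' 0" using better(4)[of 0] by simp
    have "s \<in> rational_funs k"
      using better(1,2) q'0 unfolding s_def rational_funs_def by simp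
    then have "Linfty_norm01 (\<lambda>t. rat_eval r t - t powr \<alpha>) \<le> Linfty_norm01 (\<lambda>t. rat_eval s t - t powr \<alpha>)"
      using BURA unfolding is_BURA_def by blast
    also have "\<dots> \<le> ereal E'"
      using better(5) q'0 by (intro Linfty_norm01_le) (simp add: rat_eval_def s_def abs_minus_commute)
    finally have norm: "Linfty_norm01 (\<lambda>t. rat_eval r t - t powr \<alpha>) \<le> ereal E'" .
    have "{0..1} \<subseteq> {t \<in> {0..1}. \<bar>e t\<bar> \<le> E'}"
    proof (rule Linfty_norm01_le_imp_closed[OF norm])
      show "finite {t. poly g t = 0}" using \<open>g \<noteq> 0\<close> by (rule poly_roots_finite)
      show "closed {t \<in> {0..1}. \<bar>e t\<bar> \<le> E'}"
        by (intro continuous_on_closed_Collect_le cont continuous_intros closed_atLeastAtMost)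
      show "t \<in> {t \<in> {0..1}. \<bar>e t\<bar> \<le> E'}"
        if "t \<in> {0<..<1}" "t \<notin> {t. poly g t = 0}" "\<bar>rat_eval r t - t powr \<alpha>\<bar> \<le> E'" for t
        using that pqg(1,2) by (auto simp: rat_eval_def e_def abs_minus_commute)
    qed
    then have "\<bar>e t0\<bar> \<le> E'" using t0(1) by auto
    then show False using better(3) by simp
  qed
  have "Suc (2 * k) \<le> card Z"
    using many few[OF finZ order.refl] deg by linarith
  then obtain Z' where "Z' \<subseteq> Z" "card Z' = Suc (2 * k)" "finite Z'"
    using obtain_subset_with_card_n by metis
  moreover have "Z \<subseteq> {0<..}" unfolding Z_def by auto
  ultimately show ?thesis using Z_eq pqg(1,2)
    by (intro exI[of _ Z']) (auto simp: mult.assoc[symmetric])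
qed

section \<open>Polynomials of a matrix\<close>

lemma matrix_power_simps [simp]:
  "matrix_power B 0 = mat 1" "matrix_power B (Suc i) = B ** matrix_power B i"
  unfolding matrix_power_def by simp_all

lemma matrix_mult_add_rdistrib:
  fixes A B :: "real^'n^'m"
  shows "(A + B) ** C = A ** C + B ** C"
  by (vector matrix_matrix_mult_def sum.distrib[symmetric] field_simps)

lemma matrix_mult_sum_right:
  fixes B :: "real^'n^'n"
  shows "B ** (\<Sum>i\<in>I. M i) = (\<Sum>i\<in>I. B ** M i)"
proof (induction I rule: infinite_finite_induct)
qed (simp_all add: matrix_add_ldistrib)

lemma poly_matrix_eq_sum:
  assumes "degree p < n"
  shows "poly_matrix p B = (\<Sum>i<n. coeff p i *\<^sub>R matrix_power B i)"
  unfolding poly_matrix_def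
  by (rule sum.mono_neutral_left) (use assms in \<open>auto simp: not_le intro!: coeff_eq_0\<close>)

lemma poly_matrix_add: "poly_matrix (p + q) B = poly_matrix p B + poly_matrix q B"
proof -
  define n where "n = Suc (max (degree p) (degree q))"
  have "degree p < n" "degree q < n" "degree (p + q) < n"
    unfolding n_def using degree_add_le_max[of p q] by auto
  then show ?thesis
    by (simp add: poly_matrix_eq_sum scaleR_add_left sum.distrib)
qed

lemma poly_matrix_pCons:
  "poly_matrix (pCons a p) B = a *\<^sub>R mat 1 + B ** poly_matrix p B"
proof -
  obtain n where n: "degree p < n" by blast
  then have "degree (pCons a p) < Suc n" by simp
  then have "poly_matrix (pCons a p) B = a *\<^sub>R mat 1 + (\<Sum>i<n. coeff p i *\<^sub>R (B ** matrix_power B i))"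
    unfolding poly_matrix_eq_sum[OF \<open>degree (pCons a p) < Suc n\<close>] sum.lessThan_Suc_shift by simp
  then show ?thesis unfolding poly_matrix_eq_sum[OF n]
    by (simp add: matrix_mult_sum_right matrix_scalar_ac scalar_matrix_assoc)
qed

lemma poly_matrix_0 [simp]: "poly_matrix 0 B = 0"
  by (simp add: poly_matrix_def)

lemma poly_matrix_1 [simp]: "poly_matrix 1 B = mat 1"
  by (simp add: poly_matrix_def)

lemma poly_matrix_smult: "poly_matrix (smult c p) B = c *\<^sub>R poly_matrix p B"
proof -
  obtain n where n: "degree p < n" by blast
  then have m: "degree (smult c p) < n" using degree_smult_le[of c p] by linarith
  show ?thesis unfolding poly_matrix_eq_sum[OF n] poly_matrix_eq_sum[OF m]
    by (simp add: scaleR_sum_right)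
qed

lemma poly_matrix_mult: "poly_matrix (p * q) B = poly_matrix p B ** poly_matrix q B"
proof (induction p)
  case (pCons a p)
  then show ?case
    by (simp add: poly_matrix_add poly_matrix_smult poly_matrix_pCons matrix_mult_add_rdistrib
        matrix_mul_assoc scalar_matrix_assoc[symmetric])
qed simp

lemma poly_matrix_sum: "poly_matrix (\<Sum>i\<in>I. f i) B = (\<Sum>i\<in>I. poly_matrix (f i) B)"
  by (induction I rule: infinite_finite_induct) (simp_all add: poly_matrix_add)

lemma poly_matrix_prod_invertible:
  fixes B :: "real^'n^'n"
  assumes "\<And>i. i \<in> I \<Longrightarrow> invertible (poly_matrix (f i) B)"
  shows "invertible (poly_matrix (\<Prod>i\<in>I. f i) B)"
proof -
  have "invertible (mat 1 :: real^'n^'n)"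
    unfolding invertible_def by (rule exI[of _ "mat 1"]) simp
  then show ?thesis
    using assms
    by (induction I rule: infinite_finite_induct) (auto simp: poly_matrix_mult invertible_mult)
qed

section \<open>Nonnegative inverses and the conclusion\<close>

lemma positive_definite_invertible:
  assumes "positive_definite A"
  shows "invertible A"
  unfolding invertible_left_inverse matrix_left_invertible_ker
  using assms unfolding positive_definite_def by (metis inner_zero_right less_irrefl)

text \<open>
  Split \<open>x = u - v\<close> into positive and negative part.  The supports of \<open>u\<close> and \<open>v\<close> are disjoint, so
  only off-diagonal entries contribute to \<open>v \<bullet> M u \<le> 0\<close>.  Together with \<open>v \<bullet> M x \<ge> 0\<close> this
  gives \<open>v \<bullet> M v \<le> 0\<close>, and definiteness forces \<open>v = 0\<close>.
\<close>

lemma M_matrix_inverse_nonneg: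
  fixes M :: "real^'n^'n"
  assumes "positive_definite M" and off: "\<And>i j. i \<noteq> j \<Longrightarrow> M $ i $ j \<le> 0"
    and nonneg: "\<And>i. 0 \<le> (M *v x) $ i"
  shows "0 \<le> x $ i"
proof -
  define u v :: "real^'n" where "u = (\<chi> i. max (x $ i) 0)" and "v = (\<chi> i. max (- x $ i) 0)"
  have x: "x = u - v" unfolding u_def v_def by (auto simp: vec_eq_iff)
  have "v \<bullet> (M *v u) \<le> 0"
    unfolding inner_vec_def matrix_vector_mult_def
  proof (simp add: sum_distrib_left, intro sum_nonpos)
    fix i j
    show "v $ i * (M $ i $ j * u $ j) \<le> 0"
    proof (cases "i = j")
      case True
      then show ?thesis unfolding u_def v_def by (auto simp: max_def)
    next
      case False
      have "0 \<le> v $ i * u $ j" unfolding u_def v_def by simp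
      then have "(v $ i * u $ j) * M $ i $ j \<le> 0" using off[OF False] by (rule mult_nonneg_nonpos)
      then show ?thesis by (simp only: ac_simps)
    qed
  qed
  moreover have "0 \<le> v \<bullet> (M *v x)"
    unfolding inner_vec_def using nonneg by (auto intro!: sum_nonneg simp: v_def)
  moreover have "v \<bullet> (M *v x) = v \<bullet> (M *v u) - v \<bullet> (M *v v)"
    unfolding x by (simp add: matrix_vector_mult_diff_distrib inner_diff_right)
  ultimately have "\<not> 0 < v \<bullet> (M *v v)" by linarith
  then have "v = 0" using assms(1) unfolding positive_definite_def by blast
  then have "max (- x $ i) 0 = 0" unfolding v_def by (metis vec_lambda_beta zero_index)
  then show ?thesis by linarith
qed

lemma matrix_mult_matrix_inv: "invertible A \<Longrightarrow> A ** matrix_inv A = mat 1"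
  unfolding matrix_inv_def invertible_def by (rule someI2_ex) auto

lemma matrix_inv_scaleR_left:
  fixes A :: "real^'n^'n"
  assumes "invertible A" "l \<noteq> 0"
  shows "(1 / l) *\<^sub>R A ** (l *\<^sub>R matrix_inv A) = mat 1"
  using assms by (simp add: matrix_scalar_ac scalar_matrix_assoc[symmetric] matrix_mult_matrix_inv)

text \<open>
  For \<open>B = l A\<^bsup>-1\<^esup>\<close> the summand \<open>B (1 - B/d)\<^bsup>-1\<^esup>\<close> equals \<open>(A/l - 1/d)\<^bsup>-1\<^esup>\<close>, the
  inverse of \<open>A/l\<close> shifted by the positive number \<open>- 1/d\<close>.  Such a matrix is again positive definite
  with nonpositive off-diagonal entries, so its inverse preserves nonnegativity.
\<close>

lemma partial_fraction_matrix_nonneg: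
  fixes A :: "real^'n^'n" and f :: "real^'n"
  assumes A: "positive_definite A" "M_matrix A" and l: "0 < l"
    and D: "finite D" "D \<subseteq> {..<0}" and c: "0 \<le> c" and e: "\<And>d. d \<in> D \<Longrightarrow> 0 < e d"
    and q: "q = (\<Prod>d\<in>D. [:1, - 1 / d:])"
    and p: "p = smult c q + (\<Sum>d\<in>D. smult (e d) ([:0, 1:] * (\<Prod>d'\<in>D - {d}. [:1, - 1 / d':])))"
    and f: "\<And>i. 0 \<le> f $ i"
  shows "0 \<le> (rat_matrix (p, q) (l *\<^sub>R matrix_inv A) *v f) $ i"
proof -
  define B where "B = l *\<^sub>R matrix_inv A"
  define Q where "Q d = (\<Prod>d'\<in>D - {d}. [:1, - 1 / d':])" for d
  define M where "M d = (1 / l) *\<^sub>R A + (- 1 / d) *\<^sub>R mat 1" for d :: real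
  have AB: "(1 / l) *\<^sub>R A ** B = mat 1"
    unfolding B_def using matrix_inv_scaleR_left positive_definite_invertible A(1) l by force
  have BA: "B ** ((1 / l) *\<^sub>R A) = mat 1" using AB matrix_left_right_inverse by blast
  have M_pd: "positive_definite (M d)" if "d \<in> D" for d
    unfolding positive_definite_def
  proof (intro allI impI)
    fix x :: "real^'n" assume "x \<noteq> 0"
    have "d < 0" using that D(2) by auto
    have "x \<bullet> (M d *v x) = (1 / l) * (x \<bullet> (A *v x)) + (- 1 / d) * (x \<bullet> x)"
      unfolding M_def by (simp add: matrix_vector_mult_diff_rdistrib inner_diff_right
          scaleR_matrix_vector_assoc[symmetric])
    moreover have "0 < (1 / l) * (x \<bullet> (A *v x))"
      using A(1) l \<open>x \<noteq> 0\<close> unfolding positive_definite_def by simp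
    moreover have "0 \<le> (- 1 / d) * (x \<bullet> x)" using \<open>d < 0\<close> by (intro mult_nonneg_nonneg) (auto simp: divide_nonpos_neg)
    ultimately show "0 < x \<bullet> (M d *v x)" by linarith
  qed
  have "poly_matrix [:1, s:] B = B ** ((1 / l) *\<^sub>R A + s *\<^sub>R mat 1)" for s
    using BA
    by (simp add: poly_matrix_pCons matrix_add_ldistrib matrix_scalar_ac scalar_matrix_assoc[symmetric])
  then have lin: "poly_matrix [:1, - 1 / d:] B = B ** M d" for d
    unfolding M_def .
  have "((1 / l) *\<^sub>R A + s *\<^sub>R mat 1) ** B = poly_matrix [:1, s:] B" for s
    using AB
    by (simp add: poly_matrix_pCons matrix_mult_add_rdistrib matrix_scalar_ac scalar_matrix_assoc[symmetric])
  then have MB: "M d ** B = poly_matrix [:1, - 1 / d:] B" for d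
    unfolding M_def .
  have "invertible B" unfolding invertible_left_inverse using AB by blast
  then have "invertible (poly_matrix [:1, - 1 / d:] B)" if "d \<in> D" for d
    unfolding lin using positive_definite_invertible[OF M_pd[OF that]] invertible_mult by blast
  then have q_inv: "invertible (poly_matrix q B)"
    unfolding q by (rule poly_matrix_prod_invertible)
  define y where "y = matrix_inv (poly_matrix q B) *v f"
  have fy: "poly_matrix q B *v y = f"
    unfolding y_def by (simp add: matrix_vector_mul_assoc matrix_mult_matrix_inv[OF q_inv])
  \<comment> \<open>The vector \<open>x d\<close> is the solution of \<open>M d *v x d = f\<close>.\<close>
  define x where "x d = (B ** poly_matrix (Q d) B) *v y" for d
  have x_nonneg: "0 \<le> x d $ j" if d: "d \<in> D" for d j
  proof (rule M_matrix_inverse_nonneg[OF M_pd[OF d]])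
    show "M d $ i $ j \<le> 0" if "i \<noteq> j" for i j
      using A(2) l that unfolding M_def M_matrix_def by (simp add: mat_def divide_nonpos_pos)
    have "q = [:1, - 1 / d:] * Q d"
      unfolding q Q_def using D(1) d by (subst prod.remove[of _ d]) auto
    then have "M d ** (B ** poly_matrix (Q d) B) = poly_matrix q B"
      by (simp only: matrix_mul_assoc MB poly_matrix_mult)
    then have "M d *v x d = f" unfolding x_def using fy by (simp add: matrix_vector_mul_assoc)
    then show "0 \<le> (M d *v x d) $ i" for i using f by simp
  qed
  have "poly_matrix [:0, 1:] B = B" by (simp add: poly_matrix_pCons)
  then have P: "poly_matrix p B = c *\<^sub>R poly_matrix q B + (\<Sum>d\<in>D. e d *\<^sub>R (B ** poly_matrix (Q d) B))"
    unfolding p Q_def[symmetric]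
    by (simp only: poly_matrix_add poly_matrix_smult poly_matrix_sum poly_matrix_mult)
  have sum_mv: "(\<Sum>d\<in>I. N d) *v v = (\<Sum>d\<in>I. N d *v v)" for I and N :: "real \<Rightarrow> real^'n^'n" and v
    by (induction I rule: infinite_finite_induct) (simp_all add: matrix_vector_mult_add_rdistrib)
  have "rat_matrix (p, q) B *v f = poly_matrix p B *v y"
    unfolding rat_matrix_def y_def by (simp add: matrix_vector_mul_assoc)
  also have "\<dots> = c *\<^sub>R f + (\<Sum>d\<in>D. e d *\<^sub>R x d)"
    unfolding P x_def
    by (simp add: matrix_vector_mult_add_rdistrib sum_mv scaleR_matrix_vector_assoc[symmetric] fy)
  finally show ?thesis
    unfolding B_def[symmetric] using c f e x_nonneg
    by (auto intro!: add_nonneg_nonneg sum_nonneg mult_nonneg_nonneg simp: less_imp_le)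
qed

theorem proposition2p2:
  fixes \<alpha> lam1 :: real and k :: nat
    and A :: "real^'n^'n" and f w :: "real^'n"
    and r :: "real poly \<times> real poly"
  assumes "0 < \<alpha>" and "\<alpha> < 1" and "k \<ge> 1"
    and "is_BURA \<alpha> k r"
    and "symmetric_matrix A" and "positive_definite A"
    and "smallest_eigenvalue A lam1" and "lam1 > 0"
    and "M_matrix A"
    and "\<forall>i. f $ i \<ge> 0"
    and "w = lam1 powr (- \<alpha>) *\<^sub>R (rat_matrix r (lam1 *\<^sub>R matrix_inv A) *v f)"
  shows "\<forall>i. w $ i \<ge> 0"
proof -
  obtain Z where Z: "finite Z" "Z \<subseteq> {0<..}" "card Z = Suc (2 * k)"
    "\<And>z. z \<in> Z \<Longrightarrow> z powr \<alpha> * poly (snd r) z = poly (fst r) z"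
    using BURA_interpolates[OF assms(1,2,4)] by blast
  have "degree (fst r) \<le> k" "degree (snd r) \<le> k" "poly (snd r) 0 = 1" "0 < k"
    using assms(3,4) unfolding is_BURA_def rational_funs_def by auto
  then obtain D c e where "finite D" "D \<subseteq> {..<0}" "0 \<le> c" "\<forall>d\<in>D. 0 < e d"
    "snd r = (\<Prod>d\<in>D. [:1, - 1 / d:])"
    "fst r = smult c (snd r) + (\<Sum>d\<in>D. smult (e d) ([:0, 1:] * (\<Prod>d'\<in>D - {d}. [:1, - 1 / d':])))"
    using interpolant_partial_fractions[OF assms(1,2) _ _ _ _ Z] by blast
  then have "0 \<le> (rat_matrix (fst r, snd r) (lam1 *\<^sub>R matrix_inv A) *v f) $ i" for i
    using assms(6,8,9,10) by (intro partial_fraction_matrix_nonneg[of A lam1 D c e]) auto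
  then show ?thesis using assms(11) by simp
qed

end
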